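(* Let $S_1, S_2$ be $1$-extendable word-hyperbolic semigroups. Then the semigroup free product $S_1 \ast S_2$ is word-hyperbolic.
   Context: For a word $w = a_1 a_2\cdots a_n$ write $w^{\mathrm{rev}} = a_n \cdots a_2 a_1$. Let $S$ be a semigroup generated by a finite set $A$, with associated surjective homomorphism $\pi_S\colon A^+ \to S$; for words $u,v$, $u =_S v$ means $\pi_S(u)=\pi_S(v)$. A regular combing of $S$ is a regular language $R \subseteq A^+$ with $\pi_S(R)=S$. Let $\#_1,\#_2$ be two new symbols not in $A$. The multiplication table of $S$ with respect to $R$ is $\mathcal{T}_S(R) = \{ u \#_1 v \#_2 w^{\mathrm{rev}} \mid u,v,w\in R,\ u\cdot v =_S w\}$. The semigroup $S$ is word-hyperbolic (with respect to the combing $R$) if $\mathcal{T}_S(R)$ is a context-free language; $S$ is word-hyperbolic if this holds for some finite generating set and some regular combing. For monoids, the same definitions are used with $A^\ast$ (and surjective monoid homomorphisms $A^\ast\to M$) in place of $A^+$. For a semigroup $S$, $S^{\mathbb{1}}$ denotes $S$ with a new identity element $\mathbb{1}$ adjoined, regardless of whether $S$ already has an identity. If $S$ is word-hyperbolic with respect to the regular combing $R\subseteq A^+$, then $S$ is called $1$-extendable (relative to this combing) if the monoid $S^{\mathbb{1}}$ is word-hyperbolic with respect to the regular combing $R\cup\{\varepsilon\}$, where the empty word $\varepsilon$ represents $\mathbb{1}$. In the claim, each $S_i$ is word-hyperbolic and $1$-extendable with respect to some regular combing $R_i\subseteq A_i^+$. The semigroup free product of $S_1=\mathrm{Sgp}\langle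 A_1\mid \mathscr{R}_1\rangle$ and $S_2=\mathrm{Sgp}\langle A_2\mid \mathscr{R}_2\rangle$ with $A_1\cap A_2=\varnothing$ is $\mathrm{Sgp}\langle A_1\cup A_2\mid \mathscr{R}_1\cup\mathscr{R}_2\rangle$, i.e. the coproduct in the category of semigroups. *)

theory Defs
  imports "HOL-Algebra.Group"
begin

section \<open>Regular and context-free languages\<close>

definition plus_words :: "'a set \<Rightarrow> 'a list set" where
  "plus_words A = lists A - {[]}"

text \<open>The states of a finite automaton, and below the nonterminals of a grammar, are natural
  numbers: HOL cannot quantify over types inside a formula, and every finite set embeds in the
  naturals.\<close>

definition regular_lang :: "'a set \<Rightarrow> 'a list set \<Rightarrow> bool" where
  "regular_lang A L \<longleftrightarrow>
     (\<exists>(Q :: nat set) q0 F \<delta>.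
        finite Q \<and> q0 \<in> Q \<and> F \<subseteq> Q \<and> (\<forall>q\<in>Q. \<forall>a\<in>A. \<delta> q a \<in> Q) \<and>
        L = {w \<in> lists A. foldl \<delta> q0 w \<in> F})"

datatype ('n, 't) sym = Nt 'n | Tm 't

type_synonym ('n, 't) prods = "('n \<times> ('n, 't) sym list) set"

inductive derives1 :: "('n, 't) prods \<Rightarrow> ('n, 't) sym list \<Rightarrow> ('n, 't) sym list \<Rightarrow> bool"
  for P where
  "(X, \<alpha>) \<in> P \<Longrightarrow> derives1 P (u @ [Nt X] @ v) (u @ \<alpha> @ v)"

definition cfg_lang :: "('n, 't) prods \<Rightarrow> 'n \<Rightarrow> 't list set" where
  "cfg_lang P X = {w. (derives1 P)\<^sup>*\<^sup>* [Nt X] (map Tm w)}"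

text \<open>The terminal alphabet is left implicit; only the finitely many terminals occurring in the
  productions can occur in the language.\<close>

definition context_free :: "'t list set \<Rightarrow> bool" where
  "context_free L \<longleftrightarrow> (\<exists>(P :: (nat, 't) prods) X. finite P \<and> L = cfg_lang P X)"


section \<open>Semigroups and presentations\<close>

record 'a sgrp = "'a partial_object" +
  smult :: "['a, 'a] \<Rightarrow> 'a" (infixl "\<odot>\<index>" 70)

text \<open>The empty semigroup is allowed.\<close>

locale sgrp =
  fixes S (structure)
  assumes smult_closed: "\<lbrakk>x \<in> carrier S; y \<in> carrier S\<rbrakk> \<Longrightarrow> x \<odot> y \<in> carrier S"
    and smult_assoc: "\<lbrakk>x \<in> carrier S; y \<in> carrier S; z \<in> carrier S\<rbrakk>
      \<Longrightarrow> (x \<odot> y) \<odot> z = x \<odot> (y \<odot> z)"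

definition sgrp_iso :: "('a, 'm) sgrp_scheme \<Rightarrow> ('b, 'n) sgrp_scheme \<Rightarrow> ('a \<Rightarrow> 'b) set" where
  "sgrp_iso S T = {f. bij_betw f (carrier S) (carrier T) \<and>
     (\<forall>x\<in>carrier S. \<forall>y\<in>carrier S. f (x \<odot>\<^bsub>S\<^esub> y) = f x \<odot>\<^bsub>T\<^esub> f y)}"

inductive_set cong_gen :: "'a set \<Rightarrow> ('a list \<times> 'a list) set \<Rightarrow> ('a list \<times> 'a list) set"
  for A \<rho> where
  base: "(u, v) \<in> \<rho> \<Longrightarrow> (u, v) \<in> cong_gen A \<rho>"
| refl: "u \<in> plus_words A \<Longrightarrow> (u, u) \<in> cong_gen A \<rho>"
| sym: "(u, v) \<in> cong_gen A \<rho> \<Longrightarrow> (v, u) \<in> cong_gen A \<rho>"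
| trans: "(u, v) \<in> cong_gen A \<rho> \<Longrightarrow> (v, w) \<in> cong_gen A \<rho> \<Longrightarrow> (u, w) \<in> cong_gen A \<rho>"
| mult: "(u, v) \<in> cong_gen A \<rho> \<Longrightarrow> (u', v') \<in> cong_gen A \<rho>
    \<Longrightarrow> (u @ u', v @ v') \<in> cong_gen A \<rho>"

definition Sgp :: "'a set \<Rightarrow> ('a list \<times> 'a list) set \<Rightarrow> 'a list set sgrp" where
  "Sgp A \<rho> = \<lparr>carrier = plus_words A // cong_gen A \<rho>,
     smult = (\<lambda>X Y. \<Union>u\<in>X. \<Union>v\<in>Y. cong_gen A \<rho> `` {u @ v})\<rparr>"

definition presents :: "'a set \<Rightarrow> ('a list \<times> 'a list) set \<Rightarrow> ('s, 'm) sgrp_scheme \<Rightarrow> bool" where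
  "presents A \<rho> S \<longleftrightarrow> \<rho> \<subseteq> plus_words A \<times> plus_words A \<and> sgrp_iso (Sgp A \<rho>) S \<noteq> {}"

text \<open>If \<open>A1\<close> and \<open>A2\<close> are disjoint, this is the semigroup free product of the semigroups
  presented by \<open>(A1, \<rho>1)\<close> and \<open>(A2, \<rho>2)\<close>.\<close>

definition free_product ::
  "'a set \<Rightarrow> ('a list \<times> 'a list) set \<Rightarrow> 'a set \<Rightarrow> ('a list \<times> 'a list) set \<Rightarrow> 'a list set sgrp" where
  "free_product A1 \<rho>1 A2 \<rho>2 = Sgp (A1 \<union> A2) (\<rho>1 \<union> \<rho>2)"

lemma plus_words_append: "u \<in> plus_words A \<Longrightarrow> v \<in> plus_words A \<Longrightarrow> u @ v \<in> plus_words A"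
  by (auto simp: plus_words_def)

lemma cong_gen_subset:
  assumes "\<rho> \<subseteq> plus_words A \<times> plus_words A"
  shows "cong_gen A \<rho> \<subseteq> plus_words A \<times> plus_words A"
proof -
  have "u \<in> plus_words A \<and> v \<in> plus_words A" if "(u, v) \<in> cong_gen A \<rho>" for u v
    using that by induction (use assms plus_words_append in blast)+
  then show ?thesis by auto
qed

lemma equiv_cong_gen:
  assumes "\<rho> \<subseteq> plus_words A \<times> plus_words A"
  shows "equiv (plus_words A) (cong_gen A \<rho>)"
proof (rule equivI)
  show "cong_gen A \<rho> \<subseteq> plus_words A \<times> plus_words A"
    by (rule cong_gen_subset[OF assms])
  show "refl_on (plus_words A) (cong_gen A \<rho>)"
    by (rule refl_onI) (rule cong_gen.refl)
  show "sym (cong_gen A \<rho>)"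
    by (rule symI) (rule cong_gen.sym)
  show "trans (cong_gen A \<rho>)"
    by (rule transI) (rule cong_gen.trans)
qed

lemma Sgp_smult_class:
  assumes "\<rho> \<subseteq> plus_words A \<times> plus_words A" "u \<in> plus_words A" "v \<in> plus_words A"
  shows "cong_gen A \<rho> `` {u} \<odot>\<^bsub>Sgp A \<rho>\<^esub> cong_gen A \<rho> `` {v} = cong_gen A \<rho> `` {u @ v}"
    (is "?l = ?r")
proof -
  have eq: "cong_gen A \<rho> `` {u' @ v'} = ?r"
    if "u' \<in> cong_gen A \<rho> `` {u}" "v' \<in> cong_gen A \<rho> `` {v}" for u' v'
  proof -
    have "(u @ v, u' @ v') \<in> cong_gen A \<rho>"
      using that by (simp add: cong_gen.mult)
    then show ?thesis
      by (rule equiv_class_eq[OF equiv_cong_gen[OF assms(1)], symmetric])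
  qed
  have "u \<in> cong_gen A \<rho> `` {u}" "v \<in> cong_gen A \<rho> `` {v}"
    using assms(2,3) by (simp_all add: cong_gen.refl)
  moreover have "?l = (\<Union>u'\<in>cong_gen A \<rho> `` {u}. \<Union>v'\<in>cong_gen A \<rho> `` {v}. cong_gen A \<rho> `` {u' @ v'})"
    by (simp only: Sgp_def sgrp.simps)
  moreover have "\<dots> = (\<Union>u'\<in>cong_gen A \<rho> `` {u}. \<Union>v'\<in>cong_gen A \<rho> `` {v}. ?r)"
    by (intro SUP_cong HOL.refl eq)
  ultimately show ?thesis by blast
qed

lemma sgrp_Sgp:
  assumes "\<rho> \<subseteq> plus_words A \<times> plus_words A"
  shows "sgrp (Sgp A \<rho>)"
proof -
  have car: "carrier (Sgp A \<rho>) = (\<lambda>u. cong_gen A \<rho> `` {u}) ` plus_words A"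
    by (auto simp: Sgp_def quotient_def)
  show ?thesis
    by (rule sgrp.intro; unfold car; elim imageE)
      (simp_all add: Sgp_smult_class[OF assms] plus_words_append)
qed


section \<open>Word-hyperbolicity\<close>

datatype 'a marked = Letter 'a | Hash1 | Hash2

definition mult_table :: "('a list \<Rightarrow> 's) \<Rightarrow> 'a list set \<Rightarrow> 'a marked list set" where
  "mult_table \<pi> R =
     {map Letter u @ [Hash1] @ map Letter v @ [Hash2] @ map Letter (rev w) | u v w.
        u \<in> R \<and> v \<in> R \<and> w \<in> R \<and> \<pi> (u @ v) = \<pi> w}"

text \<open>\<open>\<pi>\<close> is only meaningful on nonempty words over \<open>A\<close> (on all words over \<open>A\<close> for monoids).\<close>

definition sgrp_epi :: "'a set \<Rightarrow> ('a list \<Rightarrow> 's) \<Rightarrow> ('s, 'm) sgrp_scheme \<Rightarrow> bool" where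
  "sgrp_epi A \<pi> S \<longleftrightarrow> \<pi> ` plus_words A = carrier S \<and>
     (\<forall>u\<in>plus_words A. \<forall>v\<in>plus_words A. \<pi> (u @ v) = \<pi> u \<odot>\<^bsub>S\<^esub> \<pi> v)"

definition monoid_epi :: "'a set \<Rightarrow> ('a list \<Rightarrow> 's) \<Rightarrow> ('s, 'm) monoid_scheme \<Rightarrow> bool" where
  "monoid_epi A \<pi> M \<longleftrightarrow> \<pi> ` lists A = carrier M \<and> \<pi> [] = \<one>\<^bsub>M\<^esub> \<and>
     (\<forall>u\<in>lists A. \<forall>v\<in>lists A. \<pi> (u @ v) = \<pi> u \<otimes>\<^bsub>M\<^esub> \<pi> v)"

definition sgrp_combing ::
  "('s, 'm) sgrp_scheme \<Rightarrow> 'a set \<Rightarrow> ('a list \<Rightarrow> 's) \<Rightarrow> 'a list set \<Rightarrow> bool" where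
  "sgrp_combing S A \<pi> R \<longleftrightarrow> finite A \<and> sgrp_epi A \<pi> S \<and>
     regular_lang A R \<and> R \<subseteq> plus_words A \<and> \<pi> ` R = carrier S"

definition monoid_combing ::
  "('s, 'm) monoid_scheme \<Rightarrow> 'a set \<Rightarrow> ('a list \<Rightarrow> 's) \<Rightarrow> 'a list set \<Rightarrow> bool" where
  "monoid_combing M A \<pi> R \<longleftrightarrow> finite A \<and> monoid_epi A \<pi> M \<and>
     regular_lang A R \<and> R \<subseteq> lists A \<and> \<pi> ` R = carrier M"

definition word_hyperbolic_wrt ::
  "('s, 'm) sgrp_scheme \<Rightarrow> 'a set \<Rightarrow> ('a list \<Rightarrow> 's) \<Rightarrow> 'a list set \<Rightarrow> bool" where
  "word_hyperbolic_wrt S A \<pi> R \<longleftrightarrow> sgrp_combing S A \<pi> R \<and> context_free (mult_table \<pi> R)"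

definition monoid_word_hyperbolic_wrt ::
  "('s, 'm) monoid_scheme \<Rightarrow> 'a set \<Rightarrow> ('a list \<Rightarrow> 's) \<Rightarrow> 'a list set \<Rightarrow> bool" where
  "monoid_word_hyperbolic_wrt M A \<pi> R \<longleftrightarrow>
     monoid_combing M A \<pi> R \<and> context_free (mult_table \<pi> R)"

text \<open>As above, a finite alphabet may be taken to consist of natural numbers. Distinct letters
  may represent the same element.\<close>

definition word_hyperbolic :: "('s, 'm) sgrp_scheme \<Rightarrow> bool" where
  "word_hyperbolic S \<longleftrightarrow> (\<exists>(A :: nat set) \<pi> R. word_hyperbolic_wrt S A \<pi> R)"

definition adjoin_one :: "('s, 'm) sgrp_scheme \<Rightarrow> 's option monoid" where
  "adjoin_one S = \<lparr>carrier = insert None (Some ` carrier S),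
     mult = (\<lambda>x y. case x of None \<Rightarrow> y | Some a \<Rightarrow>
                (case y of None \<Rightarrow> x | Some b \<Rightarrow> Some (a \<odot>\<^bsub>S\<^esub> b))),
     one = None\<rparr>"

lemma (in sgrp) monoid_adjoin_one: "monoid (adjoin_one S)"
  by unfold_locales (auto simp: adjoin_one_def smult_closed smult_assoc)

definition extend_one :: "('a list \<Rightarrow> 's) \<Rightarrow> 'a list \<Rightarrow> 's option" where
  "extend_one \<pi> w = (if w = [] then None else Some (\<pi> w))"

definition one_extendable_wrt ::
  "('s, 'm) sgrp_scheme \<Rightarrow> 'a set \<Rightarrow> ('a list \<Rightarrow> 's) \<Rightarrow> 'a list set \<Rightarrow> bool" where
  "one_extendable_wrt S A \<pi> R \<longleftrightarrow> word_hyperbolic_wrt S A \<pi> R \<and>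
     monoid_word_hyperbolic_wrt (adjoin_one S) A (extend_one \<pi>) (R \<union> {[]})"

definition one_extendable_word_hyperbolic :: "('s, 'm) sgrp_scheme \<Rightarrow> bool" where
  "one_extendable_word_hyperbolic S \<longleftrightarrow> (\<exists>(A :: nat set) \<pi> R. one_extendable_wrt S A \<pi> R)"

end

theory Submission
  imports Defs
begin

text \<open>Elements of the free product have normal forms: alternating products of representatives from
  the two combings. Both normal forms and congruence of words decompose along the maximal blocks over
  one alphabet, so the normal forms are regular. In a product \<open>u v = w\<close> of normal forms, the blocks
  of \<open>w\<close> are those of \<open>u\<close> followed by those of \<open>v\<close>, except that the last block of \<open>u\<close> and the
  first of \<open>v\<close> are multiplied if they come from the same factor. As \<open>w\<close> is read backwards in the
  table, this matching of blocks is nested and hence context-free. An unmultiplied block is compared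
  with a block of \<open>w\<close> by the rows and columns of the adjoined identity, that is, by the words of the
  table of \<open>S\<^sup>1\<close> with \<open>u\<close> or \<open>v\<close> empty; this is where 1-extendability is used.\<close>

text \<open>Combings need not be one-to-one, so normal forms are not unique: a block of
  \<open>u\<close> that takes part in no multiplication may reappear in \<open>w\<close> as a
  different representative of the same element. Such blocks must be compared and cannot simply be
  copied. At most one multiplication takes place because the factors of a semigroup free product
  share no identity: the product of two blocks is again a nonempty block, so it never vanishes and
  never brings its neighbours together. In a free product of monoids the merging could cascade. The
  presentations are unrelated to the combings, and their alphabets may be infinite. Each factor is
  therefore encoded as a congruence on words over the alphabet of its combing, with translations to
  and from the generators of its presentation. Both combings use natural numbers as letters, so
  their alphabets have to be made disjoint. The grammar for the product has one rule per word of a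
  table of a factor, in general infinitely many. This is why grammars are treated as systems of
  inclusions, which make sense for infinite rule sets too.\<close>

section \<open>Context-free languages as least solutions\<close>

text \<open>The value of a right-hand side when every nonterminal stands for a language. A rule
  \<open>(X, \<alpha>)\<close> becomes the inclusion
  \<open>fills I \<alpha> \<subseteq> I X\<close>; by \<open>cfg_lang_closed\<close> and
  \<open>cfg_lang_least\<close>, \<open>cfg_lang P\<close> is the least solution of these
  inclusions. Later arguments about grammars use only these two facts and no derivations.\<close>

fun fills :: "('n \<Rightarrow> 't list set) \<Rightarrow> ('n, 't) sym list \<Rightarrow> 't list set" where
  "fills I [] = {[]}"
| "fills I (Nt X # \<alpha>) = {u @ v | u v. u \<in> I X \<and> v \<in> fills I \<alpha>}"
| "fills I (Tm t # \<alpha>) = (#) t ` fills I \<alpha>"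

lemma fills_append: "fills I (\<alpha> @ \<beta>) = {u @ v | u v. u \<in> fills I \<alpha> \<and> v \<in> fills I \<beta>}"
proof (induction \<alpha>)
  case (Cons s \<alpha>)
  show ?case
  proof (cases s)
    case (Nt X)
    then show ?thesis
      using Cons by (simp; safe) (metis append_assoc)+
  next
    case (Tm t)
    then show ?thesis
      using Cons by (simp add: image_def; safe) (metis append_Cons)+
  qed
qed simp

lemma fills_map_Tm [simp]: "fills I (map Tm w) = {w}"
  by (induction w) auto

lemma derives1_context:
  assumes "derives1 P \<alpha> \<beta>"
  shows "derives1 P (u @ \<alpha> @ v) (u @ \<beta> @ v)"
  using assms
proof cases
  case (1 X \<gamma> u' v')
  then show ?thesis
    using derives1.intros[of X \<gamma> P "u @ u'" "v' @ v"] by simp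
qed

lemma derives_context:
  assumes "(derives1 P)\<^sup>*\<^sup>* \<alpha> \<beta>"
  shows "(derives1 P)\<^sup>*\<^sup>* (u @ \<alpha> @ v) (u @ \<beta> @ v)"
  using assms by induction (auto intro: derives1_context rtranclp.rtrancl_into_rtrancl)

lemma fills_cfg_lang_derives:
  "w \<in> fills (cfg_lang P) \<alpha> \<Longrightarrow> (derives1 P)\<^sup>*\<^sup>* \<alpha> (map Tm w)"
proof (induction \<alpha> arbitrary: w)
  case (Cons s \<alpha>)
  show ?case
  proof (cases s)
    case (Nt X)
    with Cons.prems obtain u v where w: "w = u @ v" "u \<in> cfg_lang P X" "v \<in> fills (cfg_lang P) \<alpha>"
      by auto
    have "(derives1 P)\<^sup>*\<^sup>* (Nt X # \<alpha>) (map Tm u @ \<alpha>)"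
      using derives_context[of P "[Nt X]" "map Tm u" "[]" \<alpha>] w(2) by (simp add: cfg_lang_def)
    also have "(derives1 P)\<^sup>*\<^sup>* \<dots> (map Tm u @ map Tm v)"
      using derives_context[OF Cons.IH[OF w(3)], of "map Tm u" "[]"] by simp
    finally show ?thesis
      by (simp add: Nt w(1))
  next
    case (Tm t)
    with Cons.prems obtain v where w: "w = t # v" "v \<in> fills (cfg_lang P) \<alpha>"
      by auto
    then show ?thesis
      using derives_context[OF Cons.IH[OF w(2)], of "[Tm t]" "[]"] by (simp add: Tm)
  qed
qed simp

lemma cfg_lang_closed:
  assumes "(X, \<alpha>) \<in> P"
  shows "fills (cfg_lang P) \<alpha> \<subseteq> cfg_lang P X"
proof
  fix w assume "w \<in> fills (cfg_lang P) \<alpha>"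
  then have "(derives1 P)\<^sup>*\<^sup>* \<alpha> (map Tm w)"
    by (rule fills_cfg_lang_derives)
  moreover have "derives1 P [Nt X] \<alpha>"
    using derives1.intros[OF assms, of "[]" "[]"] by simp
  ultimately show "w \<in> cfg_lang P X"
    by (simp add: cfg_lang_def converse_rtranclp_into_rtranclp)
qed

text \<open>A derivation step replaces \<open>X\<close> by a right-hand side whose value is
  contained in \<open>I X\<close>, so values can only shrink along a derivation, and the final word
  has the value \<open>{w}\<close>.\<close>

lemma cfg_lang_least:
  assumes closed: "\<And>X \<alpha>. (X, \<alpha>) \<in> P \<Longrightarrow> fills I \<alpha> \<subseteq> I X"
  shows "cfg_lang P X \<subseteq> I X"
proof -
  have step: "fills I \<beta> \<subseteq> fills I \<alpha>" if "derives1 P \<alpha> \<beta>" for \<alpha> \<beta>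
    using that
  proof cases
    case (1 X \<gamma> u v)
    have "fills I \<gamma> \<subseteq> fills I [Nt X]"
      using closed[OF 1(3)] by simp
    then show ?thesis
      unfolding 1(1,2) fills_append by blast
  qed
  have "fills I \<beta> \<subseteq> fills I \<alpha>" if "(derives1 P)\<^sup>*\<^sup>* \<alpha> \<beta>" for \<alpha> \<beta>
    using that by induction (use step in blast)+
  then show ?thesis
    by (fastforce simp: cfg_lang_def)
qed

lemma fills_cong:
  assumes "\<And>X. Nt X \<in> set \<alpha> \<Longrightarrow> I X = J X"
  shows "fills I \<alpha> = fills J \<alpha>"
  using assms
proof (induction \<alpha>)
  case (Cons s \<alpha>)
  then show ?case by (cases s) auto
qed simp

lemma fills_map_sym: "fills I (map (map_sym f id) \<alpha>) = fills (I \<circ> f) \<alpha>"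
proof (induction \<alpha>)
  case (Cons s \<alpha>)
  then show ?case by (cases s) auto
qed simp

text \<open>\<open>context_free\<close> asks for natural numbers as nonterminals. Finitely many
  rules mention finitely many nonterminals, which can be numbered; both inclusions then follow from
  leastness.\<close>

lemma context_free_cfg_lang:
  fixes P :: "('n, 't) prods"
  assumes "finite P"
  shows "context_free (cfg_lang P X)"
proof -
  \<comment> \<open>\<open>X\<close> is inserted because it may occur in no rule and still needs a
    number of its own.\<close>
  define N where "N = insert X (fst ` P \<union> (\<Union>(Y, \<alpha>)\<in>P. \<Union>(set1_sym ` set \<alpha>)))"
  have "finite (set1_sym s)" for s :: "('n, 't) sym"
    by (cases s) auto
  then have "finite N"
    using assms by (auto simp: N_def)
  then obtain f :: "'n \<Rightarrow> nat" where f: "inj_on f N"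
    using finite_imp_inj_to_nat_seg by blast
  define P' where "P' = (\<lambda>(Y, \<alpha>). (f Y, map (map_sym f id) \<alpha>)) ` P"
  \<comment> \<open>Outside the image of \<open>N\<close> under \<open>f\<close> the value of
    \<open>J\<close> is arbitrary, but the rules of \<open>P'\<close> only mention numbers in that
    image.\<close>
  define J where "J n = cfg_lang P (inv_into N f n)" for n
  have "cfg_lang P Y \<subseteq> (cfg_lang P' \<circ> f) Y" for Y
  proof (rule cfg_lang_least)
    fix Z \<alpha> assume "(Z, \<alpha>) \<in> P"
    then have "(f Z, map (map_sym f id) \<alpha>) \<in> P'"
      unfolding P'_def by force
    then show "fills (cfg_lang P' \<circ> f) \<alpha> \<subseteq> (cfg_lang P' \<circ> f) Z"
      using cfg_lang_closed[of "f Z" _ P'] by (fastforce simp: fills_map_sym)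
  qed
  moreover have "cfg_lang P' n \<subseteq> J n" for n
  proof (rule cfg_lang_least)
    fix m \<beta> assume "(m, \<beta>) \<in> P'"
    then obtain Y \<alpha> where Y: "(Y, \<alpha>) \<in> P" "m = f Y" "\<beta> = map (map_sym f id) \<alpha>"
      by (auto simp: P'_def)
    have "Z \<in> N" if "Nt Z \<in> set \<alpha>" for Z
      using that Y(1) by (force simp: N_def)
    then have "fills J \<beta> = fills (cfg_lang P) \<alpha>"
      unfolding Y(3) fills_map_sym by (intro fills_cong) (simp add: J_def f)
    moreover have "Y \<in> N"
      using Y(1) by (force simp: N_def)
    then have "J m = cfg_lang P Y"
      by (simp add: J_def Y(2) f)
    ultimately show "fills J \<beta> \<subseteq> J m"
      using cfg_lang_closed[OF Y(1)] by simp
  qed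
  moreover have "J (f X) = cfg_lang P X"
    using f by (simp add: J_def N_def)
  ultimately have "cfg_lang P X = cfg_lang P' (f X)"
    by fastforce
  moreover have "finite P'"
    using assms by (simp add: P'_def)
  ultimately show ?thesis
    unfolding context_free_def by blast
qed

text \<open>Union, homomorphism and substitution are special cases.\<close>

lemma context_free_system:
  fixes Rs :: "('n \<times> ('t \<Rightarrow> ('n, 'u) sym list) \<times> 't list set) set"
  assumes fin: "finite Rs" and cf: "\<And>X h L. (X, h, L) \<in> Rs \<Longrightarrow> context_free L"
  shows "context_free (cfg_lang {(X, concat (map h z)) | X h L z. (X, h, L) \<in> Rs \<and> z \<in> L} S)"
    (is "context_free (cfg_lang ?P S)")
proof -
  have "\<exists>(G :: (nat, 't) prods) s. finite G \<and> snd (snd r) = cfg_lang G s" if "r \<in> Rs" for r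
    using cf that unfolding context_free_def by (metis surjective_pairing)
  then obtain G :: "_ \<Rightarrow> (nat, 't) prods" and s
    where G: "\<And>r. r \<in> Rs \<Longrightarrow> finite (G r)" "\<And>X h L. (X, h, L) \<in> Rs \<Longrightarrow> L = cfg_lang (G (X, h, L)) (s (X, h, L))"
    by (metis snd_conv)
  \<comment> \<open>\<open>Inl X\<close> is a nonterminal of the system. \<open>Inr (r, k)\<close>
    is the nonterminal \<open>k\<close> in a private copy of the grammar for the language of
    \<open>r\<close>, in which each terminal is replaced by its image under the substitution of
    \<open>r\<close>.\<close>
  define emb where "emb r \<alpha> = concat (map (\<lambda>x. case x of Nt k \<Rightarrow> [Nt (Inr (r, k))]
      | Tm t \<Rightarrow> map (map_sym Inl id) (fst (snd r) t)) \<alpha>)"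
    for r :: "'n \<times> ('t \<Rightarrow> ('n, 'u) sym list) \<times> 't list set" and \<alpha> :: "(nat, 't) sym list"
  define Q where "Q = (\<lambda>r. (Inl (fst r), [Nt (Inr (r, s r))])) ` Rs \<union>
      (\<Union>r\<in>Rs. (\<lambda>(k, \<alpha>). (Inr (r, k), emb r \<alpha>)) ` G r)"
  have emb_simps: "emb r [] = []" "emb r (Nt k # \<alpha>) = Nt (Inr (r, k)) # emb r \<alpha>"
    "emb r (Tm t # \<alpha>) = map (map_sym Inl id) (fst (snd r) t) @ emb r \<alpha>" for r k t \<alpha>
    by (simp_all add: emb_def)
  have finQ: "finite Q"
    using fin G(1) by (simp add: Q_def)
  define I where "I Y = cfg_lang Q (Inl Y)" for Y
  have I: "I = cfg_lang Q \<circ> Inl"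
    by (auto simp: I_def)
  have "cfg_lang ?P Y \<subseteq> I Y" for Y
  proof (rule cfg_lang_least)
    fix X \<alpha> assume "(X, \<alpha>) \<in> ?P"
    then obtain h L z where r: "(X, h, L) \<in> Rs" "z \<in> L" "\<alpha> = concat (map h z)"
      by blast
    define r where "r = (X, h, L)"
    \<comment> \<open>Leastness bounds a generated language by a set, so the claim about every
      generated \<open>z\<close> is packed into the set of those \<open>z\<close> that satisfy
      it.\<close>
    define J where "J k = {z. fills I (concat (map h z)) \<subseteq> cfg_lang Q (Inr (r, k))}" for k
    have J: "fills I (concat (map h z)) \<subseteq> fills (cfg_lang Q) (emb r \<beta>)" if "z \<in> fills J \<beta>" for z \<beta>
      using that
    proof (induction \<beta> arbitrary: z)
      case (Cons x \<beta>)
      show ?case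
      proof (cases x)
        case (Nt k)
        then obtain z1 z2 where z: "z = z1 @ z2" "z1 \<in> J k" "z2 \<in> fills J \<beta>"
          using Cons.prems by auto
        then show ?thesis
          using Cons.IH[OF z(3)] by (auto simp: Nt emb_simps fills_append J_def)
      next
        case (Tm t)
        then obtain z2 where z: "z = t # z2" "z2 \<in> fills J \<beta>"
          using Cons.prems by auto
        then show ?thesis
          using Cons.IH[OF z(2)]
          by (auto simp: Tm emb_simps fills_append fills_map_sym I[symmetric] r_def)
      qed
    qed (simp add: emb_simps)
    have "cfg_lang (G r) k \<subseteq> J k" for k
    proof (rule cfg_lang_least)
      fix m \<beta> assume "(m, \<beta>) \<in> G r"
      then have "(Inr (r, m), emb r \<beta>) \<in> Q"
        using r(1) by (force simp: Q_def r_def)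
      from cfg_lang_closed[OF this] show "fills J \<beta> \<subseteq> J m"
        using J unfolding J_def[of m] by blast
    qed
    then have "z \<in> J (s r)"
      using r(2) G(2)[OF r(1)] by (auto simp: r_def)
    moreover have "cfg_lang Q (Inr (r, s r)) \<subseteq> cfg_lang Q (Inl X)"
    proof -
      have "(Inl X, [Nt (Inr (r, s r))]) \<in> Q"
        using r(1) by (force simp: Q_def r_def)
      from cfg_lang_closed[OF this] show ?thesis by simp
    qed
    ultimately show "fills I \<alpha> \<subseteq> I X"
      by (auto simp: J_def I_def r(3))
  qed
  \<comment> \<open>For the converse inclusion, \<open>Inr (r, k)\<close> is interpreted by the
    substitution image of what \<open>k\<close> generates in the original grammar.\<close>
  moreover have "cfg_lang Q Y \<subseteq> (case Y of Inl X \<Rightarrow> cfg_lang ?P X | Inr (r, k) \<Rightarrow>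
      (\<Union>z\<in>cfg_lang (G r) k. fills (cfg_lang ?P) (concat (map (fst (snd r)) z))))"
    (is "_ \<subseteq> ?J Y") for Y
  proof (rule cfg_lang_least)
    fix Y \<alpha> assume "(Y, \<alpha>) \<in> Q"
    then consider (start) X h L where "(X, h, L) \<in> Rs" "Y = Inl X" "\<alpha> = [Nt (Inr ((X, h, L), s (X, h, L)))]"
      | (prod) r k \<beta> where "r \<in> Rs" "(k, \<beta>) \<in> G r" "Y = Inr (r, k)" "\<alpha> = emb r \<beta>"
      by (auto simp: Q_def)
    then show "fills ?J \<alpha> \<subseteq> ?J Y"
    proof cases
      case start
      have "fills (cfg_lang ?P) (concat (map h z)) \<subseteq> cfg_lang ?P X" if "z \<in> L" for z
        by (rule cfg_lang_closed) (use start(1) that in blast)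
      then show ?thesis
        using start(2,3) G(2)[OF start(1)] by auto
    next
      case prod
      have *: "w \<in> (\<Union>z\<in>fills (cfg_lang (G r)) \<gamma>. fills (cfg_lang ?P) (concat (map (fst (snd r)) z)))"
        if "w \<in> fills ?J (emb r \<gamma>)" for w \<gamma>
        using that
      proof (induction \<gamma> arbitrary: w)
        case (Cons x \<gamma>)
        show ?case
        proof (cases x)
          case (Nt n)
          from Cons.prems obtain u v where w: "w = u @ v" "u \<in> ?J (Inr (r, n))" "v \<in> fills ?J (emb r \<gamma>)"
            by (auto simp: Nt emb_simps)
          from w(2) obtain z where z: "z \<in> cfg_lang (G r) n"
            "u \<in> fills (cfg_lang ?P) (concat (map (fst (snd r)) z))" by auto
          from Cons.IH[OF w(3)] obtain z' where z': "z' \<in> fills (cfg_lang (G r)) \<gamma>"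
            "v \<in> fills (cfg_lang ?P) (concat (map (fst (snd r)) z'))" by auto
          have "z @ z' \<in> fills (cfg_lang (G r)) (x # \<gamma>)"
            using z(1) z'(1) by (auto simp: Nt)
          moreover have "w \<in> fills (cfg_lang ?P) (concat (map (fst (snd r)) (z @ z')))"
            using z(2) z'(2) w(1) by (auto simp: fills_append)
          ultimately show ?thesis by blast
        next
          case (Tm t)
          have J: "?J \<circ> Inl = cfg_lang ?P"
            by auto
          from Cons.prems obtain u v where w: "w = u @ v" "u \<in> fills (cfg_lang ?P) (fst (snd r) t)" "v \<in> fills ?J (emb r \<gamma>)"
            unfolding Tm emb_simps fills_append fills_map_sym J by auto
          from Cons.IH[OF w(3)] obtain z' where z': "z' \<in> fills (cfg_lang (G r)) \<gamma>"
            "v \<in> fills (cfg_lang ?P) (concat (map (fst (snd r)) z'))" by auto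
          have "t # z' \<in> fills (cfg_lang (G r)) (x # \<gamma>)"
            using z'(1) by (auto simp: Tm)
          moreover have "w \<in> fills (cfg_lang ?P) (concat (map (fst (snd r)) (t # z')))"
            using w z'(2) by (auto simp: fills_append)
          ultimately show ?thesis by blast
        qed
      qed (simp add: emb_simps)
      show ?thesis
      proof
        fix w assume "w \<in> fills ?J \<alpha>"
        then obtain z where "z \<in> fills (cfg_lang (G r)) \<beta>"
          "w \<in> fills (cfg_lang ?P) (concat (map (fst (snd r)) z))"
          using * unfolding prod(4) by blast
        then show "w \<in> ?J Y"
          using cfg_lang_closed[OF prod(2)] by (auto simp: prod(3))
      qed
    qed
  qed
  ultimately have "cfg_lang ?P S = cfg_lang Q (Inl S)"
    by (fastforce simp: I_def)
  then show ?thesis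
    using context_free_cfg_lang[OF finQ] by simp
qed

text \<open>Presents an arbitrary language as a system with one nonterminal, the form in which
  \<open>context_free_system\<close> delivers unions and images.\<close>

lemma cfg_lang_terminal_rules: "cfg_lang {(X, map Tm w) | w. w \<in> L} X = L"
proof
  have "cfg_lang {(X, map Tm w) | w. w \<in> L} X \<subseteq> (\<lambda>_. L) X"
    by (rule cfg_lang_least) auto
  then show "cfg_lang {(X, map Tm w) | w. w \<in> L} X \<subseteq> L" .
  show "L \<subseteq> cfg_lang {(X, map Tm w) | w. w \<in> L} X"
  proof
    fix w assume "w \<in> L"
    then have "(X, map Tm w) \<in> {(X, map Tm w) | w. w \<in> L}" by blast
    from cfg_lang_closed[OF this] show "w \<in> cfg_lang {(X, map Tm w) | w. w \<in> L} X" by simp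
  qed
qed

lemma context_free_Un:
  assumes "context_free L1" "context_free L2"
  shows "context_free (L1 \<union> L2)"
proof -
  let ?Rs = "{((), \<lambda>t. [Tm t :: (unit, _) sym], L1), ((), \<lambda>t. [Tm t], L2)}"
  have "context_free (cfg_lang {(X, concat (map h z)) | X h L z. (X, h, L) \<in> ?Rs \<and> z \<in> L} ())"
    by (rule context_free_system) (use assms in auto)
  moreover have "{(X, concat (map h z)) | X h L z. (X, h, L) \<in> ?Rs \<and> z \<in> L} =
      {((), concat (map (\<lambda>t. [Tm t :: (unit, _) sym]) w)) | w. w \<in> L1 \<union> L2}"
    by blast
  ultimately show ?thesis
    by (simp only: concat_map_singleton cfg_lang_terminal_rules)
qed

lemma context_free_map:
  assumes "context_free L"
  shows "context_free (map f ` L)"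
proof -
  let ?Rs = "{((), \<lambda>t. [Tm (f t) :: (unit, _) sym], L)}"
  have "context_free (cfg_lang {(X, concat (map h z)) | X h L z. (X, h, L) \<in> ?Rs \<and> z \<in> L} ())"
    by (rule context_free_system) (use assms in auto)
  moreover have "{(X, concat (map h z)) | X h L z. (X, h, L) \<in> ?Rs \<and> z \<in> L} =
      {((), concat (map (\<lambda>t. [Tm (f t) :: (unit, _) sym]) z)) | z. z \<in> L}"
    by blast
  moreover have "\<dots> = {((), map Tm w) | w. w \<in> map f ` L}"
    by (simp add: Setcompr_eq_image image_image comp_def)
  ultimately show ?thesis
    by (simp only: cfg_lang_terminal_rules)
qed

text \<open>The nonterminal \<open>(p, X, q)\<close> stands for the words of \<open>X\<close> that
  take the automaton from \<open>p\<close> to \<open>q\<close>; \<open>path\<close> says that the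
  labels along a right-hand side fit together into a run.\<close>

fun path :: "('q \<Rightarrow> 't \<Rightarrow> 'q) \<Rightarrow> 'q \<Rightarrow> ('q \<times> 'n \<times> 'q, 't) sym list \<Rightarrow> 'q \<Rightarrow> bool" where
  "path \<delta> p [] q \<longleftrightarrow> p = q"
| "path \<delta> p (Tm t # \<alpha>) q \<longleftrightarrow> path \<delta> (\<delta> p t) \<alpha> q"
| "path \<delta> p (Nt (p', X, q') # \<alpha>) q \<longleftrightarrow> p' = p \<and> path \<delta> q' \<alpha> q"

text \<open>The product construction of Bar-Hillel, Perles and Shamir.\<close>

lemma context_free_inter_automaton:
  fixes \<delta> :: "'q :: finite \<Rightarrow> 't \<Rightarrow> 'q"
  assumes "context_free L"
  shows "context_free {w \<in> L. foldl \<delta> p w = q}"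
proof -
  obtain P :: "(nat, 't) prods" and S where P: "finite P" "L = cfg_lang P S"
    using assms unfolding context_free_def by blast
  define fg :: "('q \<times> nat \<times> 'q, 't) sym \<Rightarrow> (nat, 't) sym" where "fg = map_sym (\<lambda>(p, X, q). X) id"
  define P' where "P' = {((p, X, q), \<alpha>) | p X q \<alpha>. (X, map fg \<alpha>) \<in> P \<and> path \<delta> p \<alpha> q}"
  have fin: "finite P'"
  proof -
    \<comment> \<open>A right-hand side has only finitely many labellings, since the state type is
      finite.\<close>
    have fin: "finite {\<beta>. map fg \<beta> = \<alpha>}" for \<alpha>
    proof (induction \<alpha>)
      case (Cons s \<alpha>)
      have "{x. fg x = s} \<subseteq> (case s of Nt X \<Rightarrow> (\<lambda>(p, q). Nt (p, X, q)) ` UNIV | Tm t \<Rightarrow> {Tm t})"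
      proof
        fix x assume "x \<in> {x. fg x = s}"
        then show "x \<in> (case s of Nt X \<Rightarrow> (\<lambda>(p, q). Nt (p, X, q)) ` UNIV | Tm t \<Rightarrow> {Tm t})"
          by (cases x) (auto simp: fg_def image_iff)
      qed
      then have "finite {x. fg x = s}"
        by (rule finite_subset) (simp split: sym.split)
      moreover have "{\<beta>. map fg \<beta> = s # \<alpha>} = (\<lambda>(x, \<beta>). x # \<beta>) ` ({x. fg x = s} \<times> {\<beta>. map fg \<beta> = \<alpha>})"
        by (auto simp: map_eq_Cons_conv image_iff)
      ultimately show ?case
        using Cons by simp
    qed simp
    have "P' \<subseteq> (\<Union>(X, \<alpha>)\<in>P. (\<lambda>((p, q), \<beta>). ((p, X, q), \<beta>)) ` (UNIV \<times> {\<beta>. map fg \<beta> = \<alpha>}))"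
    proof
      fix y assume "y \<in> P'"
      then obtain p X q \<alpha> where y: "y = ((p, X, q), \<alpha>)" "(X, map fg \<alpha>) \<in> P"
        by (auto simp: P'_def)
      show "y \<in> (\<Union>(X, \<alpha>)\<in>P. (\<lambda>((p, q), \<beta>). ((p, X, q), \<beta>)) ` (UNIV \<times> {\<beta>. map fg \<beta> = \<alpha>}))"
        by (rule UN_I[OF y(2)]) (auto simp: y(1) intro!: image_eqI[of _ _ "((p, q), \<alpha>)"])
    qed
    moreover have "finite \<dots>"
      using P(1) fin by (auto intro!: finite_imageI)
    ultimately show ?thesis by (rule finite_subset)
  qed
  have le: "cfg_lang P' Y \<subseteq> (case Y of (p, X, q) \<Rightarrow> {w \<in> cfg_lang P X. foldl \<delta> p w = q})"
    (is "_ \<subseteq> ?I Y") for Y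
  proof (rule cfg_lang_least)
    have *: "w \<in> fills (cfg_lang P) (map fg \<alpha>) \<and> foldl \<delta> p w = q" if "w \<in> fills ?I \<alpha>" "path \<delta> p \<alpha> q" for w \<alpha> p q
      using that
    proof (induction \<alpha> arbitrary: w p)
      case (Cons s \<alpha>)
      then show ?case
      proof (cases s)
        case (Nt Y)
        then show ?thesis
          using Cons by (cases Y) (fastforce simp: fg_def)
      next
        case (Tm t)
        then show ?thesis
          using Cons by (fastforce simp: fg_def)
      qed
    qed simp
    fix Y \<alpha> assume "(Y, \<alpha>) \<in> P'"
    then obtain p X q where Y: "Y = (p, X, q)" "(X, map fg \<alpha>) \<in> P" "path \<delta> p \<alpha> q"
      by (auto simp: P'_def)
    show "fills ?I \<alpha> \<subseteq> ?I Y"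
      using *[OF _ Y(3)] cfg_lang_closed[OF Y(2)] by (auto simp: Y(1))
  qed
  \<comment> \<open>The start state is quantified inside the interpretation, because a nonterminal
    in the middle of a right-hand side is entered in whatever state the preceding part has
    reached.\<close>
  have ge: "cfg_lang P X \<subseteq> {w. \<forall>p. w \<in> cfg_lang P' (p, X, foldl \<delta> p w)}"
    (is "_ \<subseteq> ?J X") for X
  proof (rule cfg_lang_least)
    have *: "\<exists>\<beta>. map fg \<beta> = \<alpha> \<and> path \<delta> p \<beta> (foldl \<delta> p w) \<and> w \<in> fills (cfg_lang P') \<beta>"
      if "w \<in> fills ?J \<alpha>" for w \<alpha> p
      using that
    proof (induction \<alpha> arbitrary: w p)
      case (Cons s \<alpha>)
      show ?case
      proof (cases s)
        case (Nt X)
        then obtain u v where w: "w = u @ v" "u \<in> ?J X" "v \<in> fills ?J \<alpha>"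
          using Cons.prems by auto
        from Cons.IH[OF w(3), of "foldl \<delta> p u"] obtain \<beta> where \<beta>: "map fg \<beta> = \<alpha>"
          "path \<delta> (foldl \<delta> p u) \<beta> (foldl \<delta> p w)" "v \<in> fills (cfg_lang P') \<beta>"
          by (auto simp: w(1))
        show ?thesis
          by (rule exI[of _ "Nt (p, X, foldl \<delta> p u) # \<beta>"]) (use \<beta> w Nt in \<open>auto simp: fg_def\<close>)
      next
        case (Tm t)
        then obtain v where w: "w = t # v" "v \<in> fills ?J \<alpha>"
          using Cons.prems by auto
        from Cons.IH[OF w(2), of "\<delta> p t"] obtain \<beta> where \<beta>: "map fg \<beta> = \<alpha>"
          "path \<delta> (\<delta> p t) \<beta> (foldl \<delta> p w)" "v \<in> fills (cfg_lang P') \<beta>"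
          by (auto simp: w(1))
        show ?thesis
          by (rule exI[of _ "Tm t # \<beta>"]) (use \<beta> w Tm in \<open>auto simp: fg_def\<close>)
      qed
    qed simp
    fix X \<alpha> assume X: "(X, \<alpha>) \<in> P"
    show "fills ?J \<alpha> \<subseteq> ?J X"
    proof safe
      fix w p assume "w \<in> fills ?J \<alpha>"
      from *[OF this] obtain \<beta> where \<beta>: "map fg \<beta> = \<alpha>" "path \<delta> p \<beta> (foldl \<delta> p w)"
        "w \<in> fills (cfg_lang P') \<beta>" by blast
      then have "((p, X, foldl \<delta> p w), \<beta>) \<in> P'"
        using X by (auto simp: P'_def)
      then show "w \<in> cfg_lang P' (p, X, foldl \<delta> p w)"
        using cfg_lang_closed[of _ \<beta> P'] \<beta>(3) by blast
    qed
  qed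
  have "{w \<in> L. foldl \<delta> p w = q} = cfg_lang P' (p, S, q)"
    using le[of "(p, S, q)"] ge[of S] by (auto simp: P(2))
  then show ?thesis
    using context_free_cfg_lang[OF fin] by simp
qed

section \<open>Alternating products\<close>

lemma plus_words_induct [consumes 1, case_names letter Cons]:
  assumes "w \<in> plus_words A" "\<And>a. a \<in> A \<Longrightarrow> P [a]"
    "\<And>a w. a \<in> A \<Longrightarrow> w \<in> plus_words A \<Longrightarrow> P w \<Longrightarrow> P (a # w)"
  shows "P w"
  using assms(1)
proof (induction w)
  case (Cons a w)
  then show ?case
    using assms(2,3) by (cases "w = []") (auto simp: plus_words_def)
qed (simp add: plus_words_def)

text \<open>\<open>K i\<close> plays the role of equality in factor \<open>i\<close> between
  nonempty words over \<open>B i\<close>, so the factors themselves need not appear. Sides are truth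
  values, which makes \<open>\<not> i\<close> the other factor.\<close>

locale alternation =
  fixes B :: "bool \<Rightarrow> 'a set" and K :: "bool \<Rightarrow> ('a list \<times> 'a list) set"
    and R :: "bool \<Rightarrow> 'a list set"
  assumes disj: "B True \<inter> B False = {}"
    and K_equiv: "equiv (plus_words (B i)) (K i)"
    and K_mult: "(u, v) \<in> K i \<Longrightarrow> (u', v') \<in> K i \<Longrightarrow> (u @ u', v @ v') \<in> K i"
    and R_sub: "R i \<subseteq> plus_words (B i)"
    and R_onto: "u \<in> plus_words (B i) \<Longrightarrow> \<exists>r\<in>R i. (u, r) \<in> K i"
begin

abbreviation BB :: "'a set" where "BB \<equiv> B True \<union> B False"

text \<open>Words are compared, and decomposed, along their maximal blocks over one of the alphabets;
  the index is the side of the first block.\<close>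

inductive eqv :: "bool \<Rightarrow> 'a list \<Rightarrow> 'a list \<Rightarrow> bool" where
  single: "(u, v) \<in> K i \<Longrightarrow> eqv i u v"
| step: "(u, v) \<in> K i \<Longrightarrow> eqv (\<not> i) x y \<Longrightarrow> eqv i (u @ x) (v @ y)"

inductive alt :: "bool \<Rightarrow> 'a list \<Rightarrow> bool" where
  single: "u \<in> R i \<Longrightarrow> alt i u"
| step: "u \<in> R i \<Longrightarrow> alt (\<not> i) x \<Longrightarrow> alt i (u @ x)"

definition starts :: "bool \<Rightarrow> 'a list set" where
  "starts i = {w \<in> plus_words BB. hd w \<in> B i}"

lemma B_sub_BB: "B i \<subseteq> BB"
  by (cases i) auto

lemma disj': "a \<in> B i \<Longrightarrow> a \<in> B j \<longleftrightarrow> i = j"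
  using disj by (cases i; cases j) auto

lemma K_words:
  assumes "(u, v) \<in> K i"
  shows "u \<in> plus_words (B i)" "v \<in> plus_words (B i)"
  using assms equivE[OF K_equiv[of i]] by auto

lemma plus_words_BB: "u \<in> plus_words (B i) \<Longrightarrow> u \<in> plus_words BB"
  using B_sub_BB[of i] unfolding plus_words_def in_lists_conv_set by auto

lemma starts_block: "u \<in> plus_words (B i) \<Longrightarrow> u \<in> starts i"
  using plus_words_BB[of u i] by (cases u) (auto simp: starts_def plus_words_def)

lemma starts_append: "u \<in> plus_words (B i) \<Longrightarrow> x \<in> plus_words BB \<Longrightarrow> u @ x \<in> starts i"
  using starts_block[of u i] plus_words_append[of u BB x]
  by (auto simp: starts_def plus_words_def)

lemma starts_unique: "w \<in> starts i \<Longrightarrow> w \<in> starts j \<Longrightarrow> i = j"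
  using disj' by (auto simp: starts_def)

lemma starts_words: "w \<in> starts i \<Longrightarrow> w \<in> plus_words BB"
  by (simp add: starts_def)

lemma eqv_starts:
  assumes "eqv i x y"
  shows "x \<in> starts i" "y \<in> starts i"
  using assms by (induction) (simp_all add: starts_block starts_append K_words starts_words)

lemma alt_starts: "alt i x \<Longrightarrow> x \<in> starts i"
  by (induction rule: alt.induct) (use R_sub in \<open>auto intro: starts_block starts_append starts_words\<close>)

text \<open>The alphabets are disjoint, so the first block is the longest prefix over
  \<open>B i\<close>.\<close>

lemma block_eq:
  assumes "u \<in> plus_words (B i)" "v \<in> plus_words (B i)" "x \<in> insert [] (starts (\<not> i))"
    "y \<in> insert [] (starts (\<not> i))" "u @ x = v @ y"
  shows "u = v \<and> x = y"
proof -
  have "takeWhile (\<lambda>a. a \<in> B i) (u @ x) = u" if "u \<in> plus_words (B i)" "x \<in> insert [] (starts (\<not> i))" for u x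
  proof -
    have "takeWhile (\<lambda>a. a \<in> B i) x = []"
      using that(2) disj'[of "hd x" "\<not> i" i] by (cases x) (auto simp: starts_def)
    then show ?thesis
      using that(1) by (subst takeWhile_append2) (auto simp: plus_words_def)
  qed
  then have "u = v"
    using assms by metis
  then show ?thesis
    using assms(5) by simp
qed

text \<open>Inverting \<open>eqv\<close> yields some first block of the left word, and
  \<open>block_eq\<close> identifies it with the given one. The next three lemmas rest on the same
  argument.\<close>

lemma eqv_block_iff:
  assumes u: "u \<in> plus_words (B i)"
  shows "eqv i u w \<longleftrightarrow> (u, w) \<in> K i"
proof
  assume "eqv i u w"
  then show "(u, w) \<in> K i"
  proof cases
    case (step v v' x y)
    have "v = u \<and> x = []"
      by (rule block_eq[of v i u x "[]"])
        (use step u K_words eqv_starts in auto)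
    then show ?thesis
      using eqv_starts(1)[OF step(4)] by (simp add: starts_def plus_words_def)
  qed
qed (rule eqv.single)

lemma eqv_step_iff:
  assumes u: "u \<in> plus_words (B i)" and x: "x \<in> starts (\<not> i)"
  shows "eqv i (u @ x) w \<longleftrightarrow> (\<exists>v y. w = v @ y \<and> (u, v) \<in> K i \<and> eqv (\<not> i) x y)"
proof
  assume "eqv i (u @ x) w"
  then show "\<exists>v y. w = v @ y \<and> (u, v) \<in> K i \<and> eqv (\<not> i) x y"
  proof cases
    case single
    have "u = u @ x \<and> x = []"
      by (rule block_eq[of u i "u @ x" x "[]"]) (use single u x K_words in auto)
    then show ?thesis
      using x by (simp add: starts_def plus_words_def)
  next
    case (step a b x' y)
    have "a = u \<and> x' = x"
      by (rule block_eq[of a i u x' x]) (use step u x K_words eqv_starts in auto)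
    then show ?thesis
      using step by blast
  qed
qed (auto intro: eqv.step)

lemma alt_block_iff:
  assumes u: "u \<in> plus_words (B i)"
  shows "alt i u \<longleftrightarrow> u \<in> R i"
proof
  assume "alt i u"
  then show "u \<in> R i"
  proof cases
    case (step v x)
    have "v = u \<and> x = []"
      by (rule block_eq[of v i u x "[]"]) (use step u R_sub alt_starts in auto)
    then show ?thesis
      using alt_starts[OF step(3)] by (simp add: starts_def plus_words_def)
  qed
qed (rule alt.single)

lemma alt_step_iff:
  assumes u: "u \<in> plus_words (B i)" and x: "x \<in> starts (\<not> i)"
  shows "alt i (u @ x) \<longleftrightarrow> u \<in> R i \<and> alt (\<not> i) x"
proof
  assume "alt i (u @ x)"
  then show "u \<in> R i \<and> alt (\<not> i) x"
  proof cases
    case single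
    have "u = u @ x \<and> x = []"
      by (rule block_eq[of u i "u @ x" x "[]"]) (use single u x R_sub in auto)
    then show ?thesis
      using x by (simp add: starts_def plus_words_def)
  next
    case (step a x')
    have "a = u \<and> x' = x"
      by (rule block_eq[of a i u x' x]) (use step u x R_sub alt_starts in auto)
    then show ?thesis
      using step by blast
  qed
qed (auto intro: alt.step)

text \<open>If the seam lies between two blocks of the same side, \<open>u\<close> is absorbed into
  the first block of \<open>x\<close> by \<open>K_mult\<close>; otherwise it becomes a block of its
  own.\<close>

lemma eqv_mult_block:
  assumes "(u, v) \<in> K i" "eqv j x y"
  shows "eqv i (u @ x) (v @ y)"
proof (cases "j = i")
  case True
  from assms(2) show ?thesis
  proof cases
    case single
    then show ?thesis
      using assms(1) True by (auto intro: eqv.single K_mult)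
  next
    case (step a b x' y')
    then show ?thesis
      using eqv.step[OF K_mult[OF assms(1)], of a b x' y'] True by simp
  qed
next
  case False
  then have "j = (\<not> i)" by auto
  then show ?thesis
    using assms by (auto intro: eqv.step)
qed

lemma eqv_mult: "eqv i x y \<Longrightarrow> eqv j x' y' \<Longrightarrow> eqv i (x @ x') (y @ y')"
  by (induction rule: eqv.induct) (auto intro: eqv_mult_block simp: append_assoc)

lemma eqv_sym: "eqv i x y \<Longrightarrow> eqv i y x"
  by (induction rule: eqv.induct) (use K_equiv in \<open>auto intro: eqv.intros dest: equivE symD\<close>)

lemma K_trans: "(u, v) \<in> K i \<Longrightarrow> (v, w) \<in> K i \<Longrightarrow> (u, w) \<in> K i"
  using K_equiv[of i] by (meson equivE transE)

lemma eqv_trans: "eqv i x y \<Longrightarrow> eqv i y z \<Longrightarrow> eqv i x z"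
proof (induction arbitrary: z rule: eqv.induct)
  case (single u v i)
  then show ?case
    using eqv_block_iff[of v i z] by (auto intro: eqv.single K_trans dest: K_words)
next
  case (step u v i x y)
  from step.prems obtain w z' where z: "z = w @ z'" "(v, w) \<in> K i" "eqv (\<not> i) y z'"
    using eqv_step_iff[of v i y z] K_words[OF step.hyps(1)] eqv_starts[OF step.hyps(2)] by blast
  show ?case
    unfolding z(1) by (rule eqv.step[OF K_trans[OF step.hyps(1) z(2)] step.IH[OF z(3)]])
qed

text \<open>The congruence of the free product on words over \<open>BB\<close>, as
  \<open>pi_eq_iff\<close> will show. The side \<open>i\<close> is determined by the first
  letter.\<close>

definition Eqv :: "('a list \<times> 'a list) set" where
  "Eqv = {(x, y). \<exists>i. eqv i x y}"

lemma Eqv_mult: "(x, y) \<in> Eqv \<Longrightarrow> (x', y') \<in> Eqv \<Longrightarrow> (x @ x', y @ y') \<in> Eqv"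
  by (auto simp: Eqv_def intro: eqv_mult)

lemma K_Eqv: "(x, y) \<in> K i \<Longrightarrow> (x, y) \<in> Eqv"
  by (auto simp: Eqv_def intro: eqv.single)

lemma Eqv_sym: "(x, y) \<in> Eqv \<Longrightarrow> (y, x) \<in> Eqv"
  by (auto simp: Eqv_def intro: eqv_sym)

lemma Eqv_trans: "(x, y) \<in> Eqv \<Longrightarrow> (y, z) \<in> Eqv \<Longrightarrow> (x, z) \<in> Eqv"
  unfolding Eqv_def using eqv_trans eqv_starts starts_unique by blast

lemma K_refl: "u \<in> plus_words (B i) \<Longrightarrow> (u, u) \<in> K i"
  using K_equiv[of i] by (meson equivE refl_onD)

lemma Eqv_letter:
  assumes "a \<in> BB"
  shows "([a], [a]) \<in> Eqv"
proof -
  obtain i where "a \<in> B i"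
    using assms by blast
  then show ?thesis
    by (intro K_Eqv[of _ _ i] K_refl) (simp add: plus_words_def)
qed

text \<open>This also provides block decompositions, since a derivation of \<open>eqv i w w\<close>
  splits \<open>w\<close> into blocks; \<open>Eqv_normal_form\<close> relies on that. The word is
  assembled letter by letter, with \<open>Eqv_mult\<close> fusing letters into blocks.\<close>

lemma Eqv_refl: "w \<in> plus_words BB \<Longrightarrow> (w, w) \<in> Eqv"
proof (induction rule: plus_words_induct)
  case (Cons a w)
  then show ?case
    using Eqv_mult[OF Eqv_letter] by fastforce
qed (rule Eqv_letter)

lemma eqv_normal_form: "eqv i x y \<Longrightarrow> \<exists>r. alt i r \<and> eqv i x r"
proof (induction rule: eqv.induct)
  case (single u v i)
  then show ?case
    using R_onto K_words by (blast intro: alt.single eqv.single)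
next
  case (step u v i x y)
  then obtain r where r: "alt (\<not> i) r" "eqv (\<not> i) x r" by blast
  from step.hyps obtain s where "s \<in> R i" "(u, s) \<in> K i"
    using R_onto K_words by blast
  with r show ?case
    by (blast intro: alt.step eqv.step)
qed

definition normal_forms :: "'a list set" where
  "normal_forms = {w. \<exists>i. alt i w}"

lemma normal_forms_words: "normal_forms \<subseteq> plus_words BB"
  unfolding normal_forms_def using alt_starts starts_words by blast

lemma Eqv_normal_form: "w \<in> plus_words BB \<Longrightarrow> \<exists>r\<in>normal_forms. (w, r) \<in> Eqv"
  using Eqv_refl eqv_normal_form by (fastforce simp: normal_forms_def Eqv_def)

end

section \<open>Normal forms and their multiplication table\<close>

lemma regular_langI:
  fixes Q :: "'q set"
  assumes "finite Q" "q0 \<in> Q" "F \<subseteq> Q" "\<And>q a. q \<in> Q \<Longrightarrow> a \<in> A \<Longrightarrow> \<delta> q a \<in> Q"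
  shows "regular_lang A {w \<in> lists A. foldl \<delta> q0 w \<in> F}"
proof -
  obtain f :: "'q \<Rightarrow> nat" where f: "inj_on f Q"
    using finite_imp_inj_to_nat_seg[OF assms(1)] by blast
  define \<delta>' where "\<delta>' n a = f (\<delta> (inv_into Q f n) a)" for n a
  have run: "foldl \<delta> q w \<in> Q \<and> foldl \<delta>' (f q) w = f (foldl \<delta> q w)" if "w \<in> lists A" "q \<in> Q" for q w
    using that
  proof (induction w arbitrary: q)
    case (Cons a w)
    then show ?case
      using assms(4) f by (simp add: \<delta>'_def)
  qed simp
  have "foldl \<delta>' (f q0) w \<in> f ` F \<longleftrightarrow> foldl \<delta> q0 w \<in> F" if "w \<in> lists A" for w
    using run[OF that assms(2)] inj_on_image_mem_iff[OF f _ assms(3)] by simp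
  then have "{w \<in> lists A. foldl \<delta> q0 w \<in> F} = {w \<in> lists A. foldl \<delta>' (f q0) w \<in> f ` F}"
    by blast
  moreover have "\<forall>q\<in>f ` Q. \<forall>a\<in>A. \<delta>' q a \<in> f ` Q"
    using assms(4) f by (auto simp: \<delta>'_def)
  ultimately show ?thesis
    unfolding regular_lang_def using assms(1,2,3)
    by (intro exI[of _ "f ` Q"] exI[of _ "f q0"] exI[of _ "f ` F"] exI[of _ \<delta>']) auto
qed

text \<open>In \<open>Run i q\<close> the automaton of side \<open>i\<close> has reached
  \<open>q\<close> within the current block. Before the first letter the side is unknown, hence the
  separate state \<open>Init\<close>; it is not final, as the empty word is no normal form.\<close>

datatype block_state = Init | Dead | Run bool nat

context alternation
begin

lemma alt_iff: "alt i w \<longleftrightarrow> (\<exists>u x. w = u @ x \<and> u \<in> R i \<and> (x = [] \<or> alt (\<not> i) x))"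
  by (subst alt.simps) (auto 0 3)

lemma regular_normal_forms:
  assumes "\<And>i. regular_lang (B i) (R i)"
  shows "regular_lang BB normal_forms"
proof -
  have "\<forall>i. \<exists>(Q :: nat set) q0 F \<delta>. finite Q \<and> q0 \<in> Q \<and> F \<subseteq> Q \<and>
      (\<forall>q\<in>Q. \<forall>a\<in>B i. \<delta> q a \<in> Q) \<and> R i = {w \<in> lists (B i). foldl \<delta> q0 w \<in> F}"
    using assms unfolding regular_lang_def by simp
  from this[unfolded choice_iff] obtain Q :: "bool \<Rightarrow> nat set" and q0 F \<delta> where
    *: "\<forall>i. finite (Q i) \<and> q0 i \<in> Q i \<and> F i \<subseteq> Q i \<and> (\<forall>q\<in>Q i. \<forall>a\<in>B i. \<delta> i q a \<in> Q i) \<and>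
      R i = {w \<in> lists (B i). foldl (\<delta> i) (q0 i) w \<in> F i}"
    by (elim exE)
  have A: "finite (Q i)" "q0 i \<in> Q i" "F i \<subseteq> Q i"
    "q \<in> Q i \<Longrightarrow> a \<in> B i \<Longrightarrow> \<delta> i q a \<in> Q i" for i q a
    using * by blast+
  have R: "R i = {w \<in> lists (B i). foldl (\<delta> i) (q0 i) w \<in> F i}" for i
    using * by blast
  have R_Cons: "a # x \<in> R i \<longleftrightarrow> x \<in> lists (B i) \<and> foldl (\<delta> i) (\<delta> i (q0 i) a) x \<in> F i"
    if "a \<in> B i" for a x i
    by (subst R) (use that in simp)
  define enter where "enter a = Run (a \<in> B True) (\<delta> (a \<in> B True) (q0 (a \<in> B True)) a)" for a
  define step where "step s a = (case s of Init \<Rightarrow> enter a | Dead \<Rightarrow> Dead | Run i q \<Rightarrow>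
      if a \<in> B i then Run i (\<delta> i q a) else if q \<in> F i then enter a else Dead)" for s a
  have step_simps: "step Init a = enter a" "step Dead a = Dead"
    "step (Run i q) a = (if a \<in> B i then Run i (\<delta> i q a) else if q \<in> F i then enter a else Dead)" for i q a
    by (simp_all add: step_def)
  define final where "final = {Run i q | i q. q \<in> F i}"
  define states where "states = {Init, Dead} \<union> (\<Union>i. Run i ` Q i)"
  have states_iff: "Init \<in> states" "Dead \<in> states" "Run i q \<in> states \<longleftrightarrow> q \<in> Q i" for i q
    by (auto simp: states_def)
  have enter: "enter a = Run i (\<delta> i (q0 i) a)" if "a \<in> B i" for a i
    using disj'[OF that, of True] by (simp add: enter_def)
  have dead: "foldl step Dead w = Dead" for w
    by (induction w) (simp_all add: step_simps)
  \<comment> \<open>The part \<open>x\<close> of the current block that is still unread may be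
    empty, because \<open>q\<close> accounts for the letters already read.\<close>
  have run: "foldl step (Run i q) w \<in> final \<longleftrightarrow>
      (\<exists>x y. w = x @ y \<and> x \<in> lists (B i) \<and> foldl (\<delta> i) q x \<in> F i \<and> (y = [] \<or> alt (\<not> i) y))"
    if "w \<in> lists BB" for i q w
    using that
  proof (induction w arbitrary: i q rule: list.induct)
    case Nil
    then show ?case by (simp add: final_def)
  next
    case (Cons a w)
    then have w: "w \<in> lists BB"
      by simp
    show ?case
    proof (cases "a \<in> B i")
      case True
      have na: "\<not> alt (\<not> i) (a # z)" for z
        using alt_starts[of "\<not> i" "a # z"] True disj'[of a i "\<not> i"] by (auto simp: starts_def)
      have "foldl step (Run i q) (a # w) \<in> final \<longleftrightarrow>
          (\<exists>x y. w = x @ y \<and> x \<in> lists (B i) \<and> foldl (\<delta> i) (\<delta> i q a) x \<in> F i \<and> (y = [] \<or> alt (\<not> i) y))"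
        using Cons.IH[OF w] True by (simp add: step_simps)
      also have "\<dots> \<longleftrightarrow> (\<exists>x y. a # w = x @ y \<and> x \<in> lists (B i) \<and> foldl (\<delta> i) q x \<in> F i \<and>
          (y = [] \<or> alt (\<not> i) y))" (is "?l \<longleftrightarrow> ?r")
      proof
        assume ?l
        then obtain x y where "w = x @ y \<and> x \<in> lists (B i) \<and> foldl (\<delta> i) (\<delta> i q a) x \<in> F i \<and>
          (y = [] \<or> alt (\<not> i) y)" by blast
        then show ?r
          using True by (intro exI[of _ "a # x"] exI[of _ y]) simp
      next
        assume ?r
        then obtain x y where xy: "a # w = x @ y" "x \<in> lists (B i)" "foldl (\<delta> i) q x \<in> F i"
          "y = [] \<or> alt (\<not> i) y" by blast
        then obtain x' where "x = a # x'" "w = x' @ y"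
          using na by (cases x) auto
        then show ?l
          using xy by auto
      qed
      finally show ?thesis .
    next
      case False
      then have a: "a \<in> B (\<not> i)"
        using Cons.prems by (cases i) auto
      have "foldl step (Run i q) (a # w) \<in> final \<longleftrightarrow>
          q \<in> F i \<and> foldl step (Run (\<not> i) (\<delta> (\<not> i) (q0 (\<not> i)) a)) w \<in> final"
        using False by (simp add: step_simps enter[OF a] dead) (simp add: final_def)
      also have "\<dots> \<longleftrightarrow> q \<in> F i \<and> alt (\<not> i) (a # w)"
      proof -
        have "alt (\<not> i) (a # w) \<longleftrightarrow> (\<exists>x y. w = x @ y \<and> a # x \<in> R (\<not> i) \<and> (y = [] \<or> alt i y))"
          (is "?l \<longleftrightarrow> ?r")
        proof
          assume ?l
          then obtain u y where u: "a # w = u @ y" "u \<in> R (\<not> i)" "y = [] \<or> alt i y"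
            by (subst (asm) alt_iff) auto
          moreover have "u \<noteq> []"
            using u(2) R_sub by (auto simp: plus_words_def)
          ultimately show ?r
            by (cases u) auto
        next
          assume ?r
          then obtain x y where "w = x @ y" "a # x \<in> R (\<not> i)" "y = [] \<or> alt i y" by blast
          then show ?l
            by (subst alt_iff) (intro exI[of _ "a # x"] exI[of _ y], simp)
        qed
        also have "\<dots> \<longleftrightarrow> foldl step (Run (\<not> i) (\<delta> (\<not> i) (q0 (\<not> i)) a)) w \<in> final"
          using Cons.IH[OF w] by (simp add: R_Cons[OF a])
        finally show ?thesis by blast
      qed
      also have "\<dots> \<longleftrightarrow> (\<exists>x y. a # w = x @ y \<and> x \<in> lists (B i) \<and> foldl (\<delta> i) q x \<in> F i \<and>
          (y = [] \<or> alt (\<not> i) y))" (is "?l \<longleftrightarrow> ?r")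
      proof
        assume ?l
        then show ?r
          by (intro exI[of _ "[]"] exI[of _ "a # w"]) simp
      next
        assume ?r
        then obtain x y where xy: "a # w = x @ y" "x \<in> lists (B i)" "foldl (\<delta> i) q x \<in> F i"
          "y = [] \<or> alt (\<not> i) y" by blast
        moreover from this have "x = []"
          using False by (cases x) auto
        ultimately show ?l by auto
      qed
      finally show ?thesis .
    qed
  qed
  have init: "foldl step Init w \<in> final \<longleftrightarrow> w \<in> normal_forms" if w: "w \<in> lists BB" for w
  proof (cases w)
    case Nil
    have "[] \<notin> normal_forms"
      using normal_forms_words by (auto simp: plus_words_def)
    then show ?thesis
      by (simp add: Nil final_def)
  next
    case (Cons a v)
    then obtain i where i: "a \<in> B i" and v: "v \<in> lists BB"
      using w by auto
    have "foldl step Init w \<in> final \<longleftrightarrow> foldl step (Run i (\<delta> i (q0 i) a)) v \<in> final"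
      by (simp add: Cons step_simps enter[OF i])
    also have "\<dots> \<longleftrightarrow> (\<exists>x y. v = x @ y \<and> a # x \<in> R i \<and> (y = [] \<or> alt (\<not> i) y))"
      using run[OF v] by (simp add: R_Cons[OF i])
    also have "\<dots> \<longleftrightarrow> alt i w" (is "?l \<longleftrightarrow> ?r")
    proof
      assume ?l
      then obtain x y where "v = x @ y" "a # x \<in> R i" "y = [] \<or> alt (\<not> i) y" by blast
      then show ?r
        by (subst alt_iff) (intro exI[of _ "a # x"] exI[of _ y], simp add: Cons)
    next
      assume ?r
      then obtain u y where u: "a # v = u @ y" "u \<in> R i" "y = [] \<or> alt (\<not> i) y"
        by (subst (asm) alt_iff) (auto simp: Cons)
      moreover have "u \<noteq> []"
        using u(2) R_sub by (auto simp: plus_words_def)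
      ultimately show ?l
        by (cases u) auto
    qed
    also have "\<dots> \<longleftrightarrow> w \<in> normal_forms"
    proof
      assume "w \<in> normal_forms"
      then obtain j where "alt j w" by (auto simp: normal_forms_def)
      moreover have "i = j"
        using alt_starts[OF \<open>alt j w\<close>] i disj'[of a i j] by (simp add: Cons starts_def)
      ultimately show "alt i w" by simp
    qed (auto simp: normal_forms_def)
    finally show ?thesis .
  qed
  have "regular_lang BB {w \<in> lists BB. foldl step Init w \<in> final}"
  proof (rule regular_langI)
    show "finite states"
      using A(1) by (simp add: states_def)
    show "Init \<in> states" "final \<subseteq> states"
      using A(3)[THEN subsetD] by (auto simp: states_iff final_def)
    show "step q a \<in> states" if q: "q \<in> states" and a: "a \<in> BB" for q a
    proof -
      obtain i where i: "a \<in> B i"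
        using a by blast
      have "enter a \<in> states"
        using A(2,4) i by (simp add: states_iff enter[OF i])
      then show ?thesis
        using q A(4) by (cases q) (auto simp: states_iff step_simps)
    qed
  qed
  moreover have "{w \<in> lists BB. foldl step Init w \<in> final} = normal_forms"
    using init normal_forms_words by (auto simp: plus_words_def)
  ultimately show ?thesis by simp
qed

end

section \<open>A grammar for the multiplication table of normal forms\<close>

definition triple :: "'a list \<Rightarrow> 'a list \<Rightarrow> 'a list \<Rightarrow> 'a marked list" where
  "triple u v w = map Letter u @ [Hash1] @ map Letter v @ [Hash2] @ map Letter (rev w)"

text \<open>Makes a table word into a right-hand side with its two marks as slots. A slot is left
  empty, keeps its mark, or receives the nonterminal for the material nested inside.\<close>

fun subst_marks :: "('n, 'a marked) sym list \<Rightarrow> ('n, 'a marked) sym list \<Rightarrow> 'a marked \<Rightarrow> ('n, 'a marked) sym list" where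
  "subst_marks x y (Letter a) = [Tm (Letter a)]"
| "subst_marks x y Hash1 = x"
| "subst_marks x y Hash2 = y"

lemma subst_marks_triple:
  "concat (map (subst_marks x y) (triple u v w)) =
     map Tm (map Letter u) @ x @ map Tm (map Letter v) @ y @ map Tm (map Letter (rev w))"
proof -
  have "concat (map (subst_marks x y) (map Letter z)) = map Tm (map Letter z)" for z
    by (induction z) auto
  then show ?thesis
    by (simp add: triple_def del: map_map)
qed

text \<open>A table word \<open>u #\<^sub>1 v #\<^sub>2 w\<^sup>r\<^sup>e\<^sup>v\<close> is generated from the outside inwards:
  \<open>U i\<close> matches the next block of \<open>u\<close>, on side \<open>i\<close>, with a block of \<open>w\<close>, and \<open>V i\<close> does the same
  for \<open>v\<close> once \<open>u\<close> is exhausted.\<close>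

datatype table_nt = U bool | V bool

locale tables = alternation +
  assumes left_table: "context_free {triple u [] w | u w. u \<in> R i \<and> w \<in> R i \<and> (u, w) \<in> K i}"
    and right_table: "context_free {triple [] v w | v w. v \<in> R i \<and> w \<in> R i \<and> (v, w) \<in> K i}"
    and table: "context_free {triple u v w | u v w. u \<in> R i \<and> v \<in> R i \<and> w \<in> R i \<and> (u @ v, w) \<in> K i}"
begin

text \<open>The rules for \<open>V i\<close> treat the last block of \<open>v\<close> and any
  earlier one. Those for \<open>U i\<close> treat, in this order: a block of \<open>u\<close> that
  is not the last; the last block of \<open>u\<close> when \<open>v\<close> starts on the other
  side; the last block merged with a \<open>v\<close> that is a single block; the last block merged
  with the first of several blocks of \<open>v\<close>.\<close>

definition table_rules where
  "table_rules i =
     {(V i, subst_marks [] [Tm Hash2], {triple [] v w | v w. v \<in> R i \<and> w \<in> R i \<and> (v, w) \<in> K i}),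
      (V i, subst_marks [] [Nt (V (\<not> i))], {triple [] v w | v w. v \<in> R i \<and> w \<in> R i \<and> (v, w) \<in> K i}),
      (U i, subst_marks [] [Nt (U (\<not> i))], {triple u [] w | u w. u \<in> R i \<and> w \<in> R i \<and> (u, w) \<in> K i}),
      (U i, subst_marks [Tm Hash1] [Nt (V (\<not> i))], {triple u [] w | u w. u \<in> R i \<and> w \<in> R i \<and> (u, w) \<in> K i}),
      (U i, subst_marks [Tm Hash1] [Tm Hash2], {triple u v w | u v w. u \<in> R i \<and> v \<in> R i \<and> w \<in> R i \<and> (u @ v, w) \<in> K i}),
      (U i, subst_marks [Tm Hash1] [Nt (V (\<not> i))], {triple u v w | u v w. u \<in> R i \<and> v \<in> R i \<and> w \<in> R i \<and> (u @ v, w) \<in> K i})}"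

text \<open>There is a rule for every table word, so this set is infinite in general; the finitely
  many languages in \<open>table_rules\<close> still make \<open>context_free_system\<close>
  applicable.\<close>

definition G where
  "G = {(X, concat (map h z)) | X h L z. (X, h, L) \<in> (\<Union>i. table_rules i) \<and> z \<in> L}"

lemma context_free_G: "context_free (cfg_lang G X)"
  unfolding G_def
proof (rule context_free_system)
  show "finite (\<Union>i. table_rules i)"
    by (simp add: table_rules_def)
  show "context_free L" if "(X, h, L) \<in> (\<Union>i. table_rules i)" for X h L
    using that left_table right_table table by (auto simp: table_rules_def)
qed

lemma G_rule:
  assumes "(X, h, L) \<in> table_rules i" "z \<in> L"
  shows "fills (cfg_lang G) (concat (map h z)) \<subseteq> cfg_lang G X"
  by (rule cfg_lang_closed) (use assms in \<open>auto simp: G_def\<close>)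

lemma G_V:
  assumes "v \<in> R i" "w \<in> R i" "(v, w) \<in> K i"
  shows "map Letter v @ [Hash2] @ map Letter (rev w) \<in> cfg_lang G (V i)"
    and "z \<in> cfg_lang G (V (\<not> i)) \<Longrightarrow> map Letter v @ z @ map Letter (rev w) \<in> cfg_lang G (V i)"
proof -
  have t: "triple [] v w \<in> {triple [] v w | v w. v \<in> R i \<and> w \<in> R i \<and> (v, w) \<in> K i}"
    using assms by blast
  show "map Letter v @ [Hash2] @ map Letter (rev w) \<in> cfg_lang G (V i)"
    using G_rule[OF _ t, of "V i" "subst_marks [] [Tm Hash2]" i]
    by (simp add: table_rules_def subst_marks_triple fills_append del: map_map)
  show "map Letter v @ z @ map Letter (rev w) \<in> cfg_lang G (V i)" if "z \<in> cfg_lang G (V (\<not> i))"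
    using G_rule[OF _ t, of "V i" "subst_marks [] [Nt (V (\<not> i))]" i] that
    by (auto simp: table_rules_def subst_marks_triple fills_append simp del: map_map)
qed

lemma G_U:
  assumes "u \<in> R i" "w \<in> R i" "(u, w) \<in> K i"
  shows "z \<in> cfg_lang G (U (\<not> i)) \<Longrightarrow> map Letter u @ z @ map Letter (rev w) \<in> cfg_lang G (U i)"
    and "z \<in> cfg_lang G (V (\<not> i)) \<Longrightarrow> map Letter u @ [Hash1] @ z @ map Letter (rev w) \<in> cfg_lang G (U i)"
proof -
  have t: "triple u [] w \<in> {triple u [] w | u w. u \<in> R i \<and> w \<in> R i \<and> (u, w) \<in> K i}"
    using assms by blast
  show "map Letter u @ z @ map Letter (rev w) \<in> cfg_lang G (U i)" if "z \<in> cfg_lang G (U (\<not> i))"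
    using G_rule[OF _ t, of "U i" "subst_marks [] [Nt (U (\<not> i))]" i] that
    by (auto simp: table_rules_def subst_marks_triple fills_append simp del: map_map)
  show "map Letter u @ [Hash1] @ z @ map Letter (rev w) \<in> cfg_lang G (U i)" if "z \<in> cfg_lang G (V (\<not> i))"
    using G_rule[OF _ t, of "U i" "subst_marks [Tm Hash1] [Nt (V (\<not> i))]" i] that
    by (auto simp: table_rules_def subst_marks_triple fills_append simp del: map_map)
qed

lemma G_U_merge:
  assumes "u \<in> R i" "v \<in> R i" "w \<in> R i" "(u @ v, w) \<in> K i"
  shows "triple u v w \<in> cfg_lang G (U i)"
    and "z \<in> cfg_lang G (V (\<not> i)) \<Longrightarrow>
      map Letter u @ [Hash1] @ map Letter v @ z @ map Letter (rev w) \<in> cfg_lang G (U i)"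
proof -
  have t: "triple u v w \<in> {triple u v w | u v w. u \<in> R i \<and> v \<in> R i \<and> w \<in> R i \<and> (u @ v, w) \<in> K i}"
    using assms by blast
  show "triple u v w \<in> cfg_lang G (U i)"
    using G_rule[OF _ t, of "U i" "subst_marks [Tm Hash1] [Tm Hash2]" i]
    by (simp add: table_rules_def subst_marks_triple fills_append del: map_map) (simp add: triple_def)
  show "map Letter u @ [Hash1] @ map Letter v @ z @ map Letter (rev w) \<in> cfg_lang G (U i)"
    if "z \<in> cfg_lang G (V (\<not> i))"
    using G_rule[OF _ t, of "U i" "subst_marks [Tm Hash1] [Nt (V (\<not> i))]" i] that
    by (auto simp: table_rules_def subst_marks_triple fills_append simp del: map_map)
qed

text \<open>The intended solution of the system. In \<open>U i\<close> the side of \<open>v\<close>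
  is left open, so that it covers products with and without a merged block.\<close>

definition lang :: "table_nt \<Rightarrow> 'a marked list set" where
  "lang X = (case X of
     V i \<Rightarrow> {map Letter v @ [Hash2] @ map Letter (rev w) | v w. alt i v \<and> alt i w \<and> eqv i v w}
   | U i \<Rightarrow> {triple u v w | u v w. alt i u \<and> v \<in> normal_forms \<and> alt i w \<and> eqv i (u @ v) w})"

lemma lang_VI: "alt i v \<Longrightarrow> alt i w \<Longrightarrow> eqv i v w \<Longrightarrow>
    map Letter v @ Hash2 # map Letter (rev w) \<in> lang (V i)"
  by (auto simp: lang_def)

lemma lang_UI: "alt i u \<Longrightarrow> alt j v \<Longrightarrow> alt i w \<Longrightarrow> eqv i (u @ v) w \<Longrightarrow>
    map Letter u @ Hash1 # map Letter v @ Hash2 # map Letter (rev w) \<in> lang (U i)"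
  by (auto simp: lang_def triple_def normal_forms_def)

lemma lang_VE:
  assumes "z \<in> lang (V i)"
  obtains v w where "z = map Letter v @ Hash2 # map Letter (rev w)" "alt i v" "alt i w" "eqv i v w"
  using assms by (auto simp: lang_def)

lemma lang_UE:
  assumes "z \<in> lang (U i)"
  obtains u v w j where "z = map Letter u @ Hash1 # map Letter v @ Hash2 # map Letter (rev w)"
    "alt i u" "alt j v" "alt i w" "eqv i (u @ v) w"
  using assms by (auto simp: lang_def triple_def normal_forms_def)

text \<open>By leastness it suffices that \<open>lang\<close> satisfies the inclusions of all six
  kinds of rules. The outer blocks lie on side \<open>i\<close> and the inner words, if any, start
  on the other side, so the concatenations alternate again.\<close>

lemma G_sound: "cfg_lang G X \<subseteq> lang X"
proof (rule cfg_lang_least)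
  fix X \<alpha> assume "(X, \<alpha>) \<in> G"
  then obtain h L z i where r: "(X, h, L) \<in> table_rules i" "z \<in> L" "\<alpha> = concat (map h z)"
    by (auto simp: G_def)
  from r(1) consider
      "X = V i" "h = subst_marks [] [Tm Hash2]" "L = {triple [] v w | v w. v \<in> R i \<and> w \<in> R i \<and> (v, w) \<in> K i}"
    | "X = V i" "h = subst_marks [] [Nt (V (\<not> i))]" "L = {triple [] v w | v w. v \<in> R i \<and> w \<in> R i \<and> (v, w) \<in> K i}"
    | "X = U i" "h = subst_marks [] [Nt (U (\<not> i))]" "L = {triple u [] w | u w. u \<in> R i \<and> w \<in> R i \<and> (u, w) \<in> K i}"
    | "X = U i" "h = subst_marks [Tm Hash1] [Nt (V (\<not> i))]" "L = {triple u [] w | u w. u \<in> R i \<and> w \<in> R i \<and> (u, w) \<in> K i}"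
    | "X = U i" "h = subst_marks [Tm Hash1] [Tm Hash2]" "L = {triple u v w | u v w. u \<in> R i \<and> v \<in> R i \<and> w \<in> R i \<and> (u @ v, w) \<in> K i}"
    | "X = U i" "h = subst_marks [Tm Hash1] [Nt (V (\<not> i))]" "L = {triple u v w | u v w. u \<in> R i \<and> v \<in> R i \<and> w \<in> R i \<and> (u @ v, w) \<in> K i}"
    unfolding table_rules_def insert_iff prod.inject
    by (elim disjE conjE emptyE) (rule that, assumption, assumption, assumption)+
  then show "fills lang \<alpha> \<subseteq> lang X"
  proof cases
    case 1
    with r(2) obtain v w where vw: "z = triple [] v w" "v \<in> R i" "w \<in> R i" "(v, w) \<in> K i"
      by blast
    then show ?thesis
      using lang_VI[of i v w]
      by (simp add: 1 r(3) subst_marks_triple fills_append alt.single eqv.single del: map_map)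
  next
    case 2
    with r(2) obtain v w where vw: "z = triple [] v w" "v \<in> R i" "w \<in> R i" "(v, w) \<in> K i"
      by blast
    have "map Letter v @ y @ map Letter (rev w) \<in> lang (V i)" if "y \<in> lang (V (\<not> i))" for y
    proof -
      from that obtain v' w' where *: "y = map Letter v' @ Hash2 # map Letter (rev w')"
        "alt (\<not> i) v'" "alt (\<not> i) w'" "eqv (\<not> i) v' w'" by (rule lang_VE)
      then show ?thesis
        using lang_VI[of i "v @ v'" "w @ w'"] vw by (simp add: alt.step eqv.step)
    qed
    then show ?thesis
      by (auto simp: 2 r(3) vw(1) subst_marks_triple fills_append simp del: map_map)
  next
    case 3
    with r(2) obtain u w where uw: "z = triple u [] w" "u \<in> R i" "w \<in> R i" "(u, w) \<in> K i"
      by blast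
    have "map Letter u @ y @ map Letter (rev w) \<in> lang (U i)" if "y \<in> lang (U (\<not> i))" for y
    proof -
      from that obtain u' v' w' j where *:
        "y = map Letter u' @ Hash1 # map Letter v' @ Hash2 # map Letter (rev w')"
        "alt (\<not> i) u'" "alt j v'" "alt (\<not> i) w'" "eqv (\<not> i) (u' @ v') w'" by (rule lang_UE)
      then show ?thesis
        using lang_UI[of i "u @ u'" j v' "w @ w'"] uw by (simp add: alt.step eqv.step)
    qed
    then show ?thesis
      by (auto simp: 3 r(3) uw(1) subst_marks_triple fills_append simp del: map_map)
  next
    case 4
    with r(2) obtain u w where uw: "z = triple u [] w" "u \<in> R i" "w \<in> R i" "(u, w) \<in> K i"
      by blast
    have "map Letter u @ Hash1 # y @ map Letter (rev w) \<in> lang (U i)" if "y \<in> lang (V (\<not> i))" for y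
    proof -
      from that obtain v' w' where *: "y = map Letter v' @ Hash2 # map Letter (rev w')"
        "alt (\<not> i) v'" "alt (\<not> i) w'" "eqv (\<not> i) v' w'" by (rule lang_VE)
      then show ?thesis
        using lang_UI[of i u "\<not> i" v' "w @ w'"] uw by (simp add: alt.intros eqv.step)
    qed
    then show ?thesis
      by (auto simp: 4 r(3) uw(1) subst_marks_triple fills_append simp del: map_map)
  next
    case 5
    with r(2) obtain u v w where uvw: "z = triple u v w" "u \<in> R i" "v \<in> R i" "w \<in> R i" "(u @ v, w) \<in> K i"
      by blast
    then show ?thesis
      using lang_UI[of i u i v w]
      by (simp add: 5 r(3) subst_marks_triple fills_append alt.single eqv.single del: map_map)
  next
    case 6
    with r(2) obtain u v w where uvw: "z = triple u v w" "u \<in> R i" "v \<in> R i" "w \<in> R i" "(u @ v, w) \<in> K i"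
      by blast
    have "map Letter u @ Hash1 # map Letter v @ y @ map Letter (rev w) \<in> lang (U i)"
      if "y \<in> lang (V (\<not> i))" for y
    proof -
      from that obtain v' w' where *: "y = map Letter v' @ Hash2 # map Letter (rev w')"
        "alt (\<not> i) v'" "alt (\<not> i) w'" "eqv (\<not> i) v' w'" by (rule lang_VE)
      then show ?thesis
        using lang_UI[of i u i "v @ v'" "w @ w'"] uvw eqv.step[OF uvw(5) *(4)]
        by (simp add: alt.intros)
    qed
    then show ?thesis
      by (auto simp: 6 r(3) uvw(1) subst_marks_triple fills_append simp del: map_map)
  qed
qed

text \<open>Peels off one layer of nesting: \<open>b\<close> is the first block of \<open>w\<close>,
  hence the last one of the reversed \<open>w\<close>, and so stands opposite the outermost block
  \<open>u\<close>.\<close>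

lemma eqv_alt_stepE:
  assumes "u \<in> plus_words (B i)" "x \<in> starts (\<not> i)" "eqv i (u @ x) w" "alt i w"
  obtains b y where "w = b @ y" "b \<in> R i" "(u, b) \<in> K i" "eqv (\<not> i) x y" "alt (\<not> i) y"
proof -
  from assms obtain b y where *: "w = b @ y" "(u, b) \<in> K i" "eqv (\<not> i) x y"
    by (auto simp: eqv_step_iff)
  with assms(4) have "b \<in> R i \<and> alt (\<not> i) y"
    using alt_step_iff[of b i y] K_words(2) eqv_starts(2) by blast
  with * that show thesis by blast
qed

lemma G_V_complete:
  assumes "alt i v" "alt i w" "eqv i v w"
  shows "map Letter v @ [Hash2] @ map Letter (rev w) \<in> cfg_lang G (V i)"
  using assms
proof (induction i v arbitrary: w rule: alt.induct)
  case (single v i)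
  then have v: "v \<in> plus_words (B i)"
    using R_sub by blast
  with single have "(v, w) \<in> K i"
    by (simp add: eqv_block_iff)
  with single show ?case
    by (auto simp: alt_block_iff K_words intro: G_V(1)[simplified])
next
  case (step v i x)
  have v: "v \<in> plus_words (B i)"
    using R_sub step.hyps by blast
  obtain b y where *: "w = b @ y" "b \<in> R i" "(v, b) \<in> K i" "eqv (\<not> i) x y" "alt (\<not> i) y"
    using eqv_alt_stepE[OF v alt_starts[OF step.hyps(2)] step.prems(2,1)] .
  show ?case
    using G_V(2)[OF step.hyps(1) *(2,3) step.IH[OF *(5,4)]] by (simp add: *(1))
qed

text \<open>\<open>v\<close> matters only at the last block of \<open>u\<close>. If \<open>v\<close>
  starts on the other side, all of it is left to \<open>V (\<not> i)\<close>; if it starts on the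
  same side, its first block is merged and only the rest, if any, is left to
  \<open>V (\<not> i)\<close>.\<close>

lemma G_U_complete:
  assumes "alt i u" "v \<in> normal_forms" "alt i w" "eqv i (u @ v) w"
  shows "triple u v w \<in> cfg_lang G (U i)"
  using assms
proof (induction i u arbitrary: w rule: alt.induct)
  case (single u i)
  then have u: "u \<in> plus_words (B i)"
    using R_sub by blast
  from single.prems(1) obtain j where "alt j v"
    by (auto simp: normal_forms_def)
  then consider "alt (\<not> i) v" | "alt i v"
    by (cases "j = i") auto
  then show ?case
  proof cases
    case 1
    obtain b y where *: "w = b @ y" "b \<in> R i" "(u, b) \<in> K i" "eqv (\<not> i) v y" "alt (\<not> i) y"
      using eqv_alt_stepE[OF u alt_starts[OF 1] single.prems(3,2)] .
    show ?thesis
      using G_U(2)[OF single.hyps *(2,3) G_V_complete[OF 1 *(5,4)]]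
      by (simp add: triple_def *(1))
  next
    case 2
    then show ?thesis
    proof cases
      case v: single
      have uv: "u @ v \<in> plus_words (B i)"
        using u v R_sub plus_words_append by blast
      with single.prems(3) have "(u @ v, w) \<in> K i"
        by (simp add: eqv_block_iff)
      then show ?thesis
        using single v by (auto simp: alt_block_iff K_words intro: G_U_merge(1))
    next
      case (step v1 x)
      have uv: "u @ v1 \<in> plus_words (B i)"
        using u step R_sub plus_words_append by blast
      have "eqv i ((u @ v1) @ x) w"
        using single.prems(3) step(1) by simp
      from eqv_alt_stepE[OF uv alt_starts[OF step(3)] this single.prems(2)]
      obtain b y where *: "w = b @ y" "b \<in> R i" "(u @ v1, b) \<in> K i" "eqv (\<not> i) x y" "alt (\<not> i) y" .
      show ?thesis
        using G_U_merge(2)[OF single.hyps step(2) *(2,3) G_V_complete[OF step(3) *(5,4)]]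
        by (simp add: triple_def *(1) step(1))
    qed
  qed
next
  case (step u i x)
  have u: "u \<in> plus_words (B i)"
    using R_sub step.hyps by blast
  have xv: "x @ v \<in> starts (\<not> i)"
    using alt_starts[OF step.hyps(2)] step.prems(1) normal_forms_words
    by (auto simp: starts_def plus_words_def)
  have "eqv i (u @ x @ v) w"
    using step.prems(3) by simp
  from eqv_alt_stepE[OF u xv this step.prems(2)]
  obtain b y where *: "w = b @ y" "b \<in> R i" "(u, b) \<in> K i" "eqv (\<not> i) (x @ v) y" "alt (\<not> i) y" .
  show ?case
    using G_U(1)[OF step.hyps(1) *(2,3) step.IH[OF step.prems(1) *(5,4)]]
    by (simp add: triple_def *(1))
qed

lemma context_free_product_table:
  "context_free {triple u v w | u v w. u \<in> normal_forms \<and> v \<in> normal_forms \<and> w \<in> normal_forms \<and>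
     (u @ v, w) \<in> Eqv}" (is "context_free ?T")
proof -
  have "?T = (\<Union>i. lang (U i))"
  proof
    show "?T \<subseteq> (\<Union>i. lang (U i))"
    proof clarify
      fix u v w assume *: "u \<in> normal_forms" "v \<in> normal_forms" "w \<in> normal_forms" "(u @ v, w) \<in> Eqv"
      then obtain i j k where ijk: "alt i u" "alt j w" "eqv k (u @ v) w"
        by (auto simp: normal_forms_def Eqv_def)
      \<comment> \<open>A word determines the side on which it starts, so the three indices
        coincide.\<close>
      have "j = k"
        using eqv_starts(2)[OF ijk(3)] alt_starts[OF ijk(2)] starts_unique by blast
      moreover have "u @ v \<in> starts i"
        using alt_starts[OF ijk(1)] *(2) normal_forms_words by (auto simp: starts_def plus_words_def)
      then have "i = k"
        using eqv_starts(1)[OF ijk(3)] starts_unique by blast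
      ultimately show "triple u v w \<in> (\<Union>i. lang (U i))"
        using ijk *(2) by (auto simp: lang_def)
    qed
    show "(\<Union>i. lang (U i)) \<subseteq> ?T"
      by (auto simp: lang_def normal_forms_def Eqv_def)
  qed
  moreover have "lang (U i) = cfg_lang G (U i)" for i
    using G_sound[of "U i"] G_U_complete by (auto simp: lang_def)
  ultimately have "?T = cfg_lang G (U True) \<union> cfg_lang G (U False)"
    by (auto simp: UNIV_bool)
  then show ?thesis
    by (simp add: context_free_Un context_free_G)
qed

end

section \<open>Comparing a combing with a presentation\<close>

text \<open>Records whether a table word starts with \<open>Hash1\<close>, and whether \<open>Hash1\<close> is immediately
  followed by \<open>Hash2\<close>; the second component is \<open>Some False\<close> just after \<open>Hash1\<close>.\<close>

fun shape_step :: "bool option \<times> bool option \<Rightarrow> 'a marked \<Rightarrow> bool option \<times> bool option" where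
  "shape_step (p, q) t =
     (case p of None \<Rightarrow> Some (t = Hash1) | Some b \<Rightarrow> Some b,
      if q = Some True \<or> q = Some False \<and> t = Hash2 then Some True
      else if t = Hash1 then Some False else None)"

lemma shape_triple:
  "foldl shape_step (None, None) (triple u v w) = (Some (u = []), if v = [] then Some True else None)"
proof -
  have letters: "foldl shape_step (Some b, q) (map Letter z) = (Some b, q)"
    if "q \<in> {None, Some True}" for b q and z :: "'a list"
    using that by (induction z) auto
  show ?thesis
    by (cases u; cases v) (auto simp: triple_def letters)
qed

lemma mult_table_triple:
  "mult_table \<pi> R = {triple u v w | u v w. u \<in> R \<and> v \<in> R \<and> w \<in> R \<and> \<pi> (u @ v) = \<pi> w}"
  by (simp add: mult_table_def triple_def)

text \<open>The automaton \<open>shape_step\<close> selects the words of the table of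
  \<open>S\<^sup>1\<close> in which exactly one factor is empty. In these \<open>w\<close> is
  nonempty, since only the empty word represents the adjoined identity, and the equation in
  \<open>S\<^sup>1\<close> becomes one in \<open>S\<close>.\<close>

lemma one_sided_tables:
  assumes cf: "context_free (mult_table (extend_one \<pi>) (R \<union> {[]}))" and R: "[] \<notin> R"
  shows "context_free {triple u [] w | u w. u \<in> R \<and> w \<in> R \<and> \<pi> u = \<pi> w}"
    and "context_free {triple [] v w | v w. v \<in> R \<and> w \<in> R \<and> \<pi> v = \<pi> w}"
proof -
  let ?T = "mult_table (extend_one \<pi>) (R \<union> {[]})"
  have ext: "extend_one \<pi> u = extend_one \<pi> w" if "u \<in> R" "w \<in> R" "\<pi> u = \<pi> w" for u w
    using that R by (auto simp: extend_one_def)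
  have "{z \<in> ?T. foldl shape_step (None, None) z = (Some False, Some True)} =
      {triple u [] w | u w. u \<in> R \<and> w \<in> R \<and> \<pi> u = \<pi> w}" (is "?l = ?r")
  proof
    show "?l \<subseteq> ?r"
    proof
      fix z assume "z \<in> ?l"
      then obtain u v w where "z = triple u v w" "u \<in> R \<union> {[]}" "w \<in> R \<union> {[]}"
        "extend_one \<pi> (u @ v) = extend_one \<pi> w" "u \<noteq> []" "v = []"
        by (auto simp: mult_table_triple shape_triple split: if_splits)
      then show "z \<in> ?r"
        by (auto simp: extend_one_def split: if_splits)
    qed
    show "?r \<subseteq> ?l"
    proof
      fix z assume "z \<in> ?r"
      then obtain u w where z: "z = triple u [] w" "u \<in> R" "w \<in> R" "\<pi> u = \<pi> w"
        by blast
      have "extend_one \<pi> (u @ []) = extend_one \<pi> w"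
        using ext[OF z(2,3,4)] by simp
      then have "z \<in> ?T"
        unfolding mult_table_triple z(1) using z(2,3) by blast
      moreover have "u \<noteq> []"
        using z(2) R by auto
      ultimately show "z \<in> ?l"
        by (simp add: z(1) shape_triple)
    qed
  qed
  then show "context_free {triple u [] w | u w. u \<in> R \<and> w \<in> R \<and> \<pi> u = \<pi> w}"
    using context_free_inter_automaton[OF cf, of shape_step "(None, None)" "(Some False, Some True)"]
    by (simp only:)
  have "{z \<in> ?T. foldl shape_step (None, None) z = (Some True, None)} =
      {triple [] v w | v w. v \<in> R \<and> w \<in> R \<and> \<pi> v = \<pi> w}" (is "?l = ?r")
  proof
    show "?l \<subseteq> ?r"
    proof
      fix z assume "z \<in> ?l"
      then obtain u v w where "z = triple u v w" "v \<in> R \<union> {[]}" "w \<in> R \<union> {[]}"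
        "extend_one \<pi> (u @ v) = extend_one \<pi> w" "u = []" "v \<noteq> []"
        by (auto simp: mult_table_triple shape_triple split: if_splits)
      then show "z \<in> ?r"
        by (auto simp: extend_one_def split: if_splits)
    qed
    show "?r \<subseteq> ?l"
    proof
      fix z assume "z \<in> ?r"
      then obtain v w where z: "z = triple [] v w" "v \<in> R" "w \<in> R" "\<pi> v = \<pi> w"
        by blast
      have "extend_one \<pi> ([] @ v) = extend_one \<pi> w"
        using ext[OF z(2,3,4)] by simp
      then have "z \<in> ?T"
        unfolding mult_table_triple z(1) using z(2,3) by blast
      moreover have "v \<noteq> []"
        using z(2) R by auto
      ultimately show "z \<in> ?l"
        by (simp add: z(1) shape_triple)
    qed
  qed
  then show "context_free {triple [] v w | v w. v \<in> R \<and> w \<in> R \<and> \<pi> v = \<pi> w}"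
    using context_free_inter_automaton[OF cf, of shape_step "(None, None)" "(Some True, None)"]
    by (simp only:)
qed

section \<open>Renaming the letters of a combing\<close>

lemma regular_lang_map:
  assumes "regular_lang A L" "inj f"
  shows "regular_lang (f ` A) (map f ` L)"
proof -
  obtain Q :: "nat set" and q0 F \<delta> where Q: "finite Q" "q0 \<in> Q" "F \<subseteq> Q"
    "\<And>q a. q \<in> Q \<Longrightarrow> a \<in> A \<Longrightarrow> \<delta> q a \<in> Q" and L: "L = {w \<in> lists A. foldl \<delta> q0 w \<in> F}"
    using assms(1) unfolding regular_lang_def by blast
  define \<delta>' where "\<delta>' q b = \<delta> q (inv_into UNIV f b)" for q b
  have "foldl \<delta>' q (map f w) = foldl \<delta> q w" for q w
    using assms(2) by (induction w arbitrary: q) (simp_all add: \<delta>'_def)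
  then have "map f ` L = {w \<in> lists (f ` A). foldl \<delta>' q0 w \<in> F}"
    by (auto simp: L lists_image)
  moreover have "regular_lang (f ` A) \<dots>"
    by (rule regular_langI[OF Q(1,2,3)]) (use assms(2) Q(4) in \<open>auto simp: \<delta>'_def\<close>)
  ultimately show ?thesis by simp
qed

text \<open>Two combings over natural numbers may share letters; injective renamings can separate
  them. Outside the range of \<open>f\<close> the inverse is arbitrary, which is harmless because
  \<open>\<pi>'\<close> matters only on words over the renamed alphabet.\<close>

lemma word_hyperbolic_wrt_rename:
  assumes "word_hyperbolic_wrt S A \<pi> R" "context_free (mult_table (extend_one \<pi>) (R \<union> {[]}))" "inj f"
  defines "\<pi>' \<equiv> \<pi> \<circ> map (inv_into UNIV f)"
  shows "word_hyperbolic_wrt S (f ` A) \<pi>' (map f ` R)"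
    and "context_free (mult_table (extend_one \<pi>') (map f ` R \<union> {[]}))"
proof -
  have inv: "map (inv_into UNIV f) (map f w) = w" for w
    using assms(3) by (simp add: comp_def map_idI)
  have \<pi>': "\<pi>' (map f u) = \<pi> u" "\<pi>' (map f u @ map f v) = \<pi> (u @ v)" for u v
    unfolding \<pi>'_def comp_def map_append inv by (rule HOL.refl)+
  have ext: "extend_one \<pi>' (map f u) = extend_one \<pi> u" for u
    by (simp add: extend_one_def \<pi>')
  have triple: "map (map_marked f) (triple u v w) = triple (map f u) (map f v) (map f w)" for u v w
    by (simp add: triple_def rev_map)
  \<comment> \<open>Stated for arbitrary evaluations so that it serves both \<open>\<pi>\<close> and
    \<open>extend_one \<pi>\<close>.\<close>
  have table: "mult_table p' (map f ` X) = map (map_marked f) ` mult_table p X"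
    if p: "\<And>u. p' (map f u) = p u" for p p' X
  proof -
    have p': "p' (map f u @ map f v) = p (u @ v)" for u v
      using p[of "u @ v"] by simp
    show ?thesis
    proof
      show "mult_table p' (map f ` X) \<subseteq> map (map_marked f) ` mult_table p X"
      proof
        fix z assume "z \<in> mult_table p' (map f ` X)"
        then obtain u v w where "z = triple (map f u) (map f v) (map f w)" "u \<in> X" "v \<in> X" "w \<in> X"
          "p' (map f u @ map f v) = p' (map f w)"
          by (auto simp: mult_table_triple)
        then show "z \<in> map (map_marked f) ` mult_table p X"
          unfolding triple[symmetric] p' p mult_table_triple by blast
      qed
      show "map (map_marked f) ` mult_table p X \<subseteq> mult_table p' (map f ` X)"
      proof
        fix z assume "z \<in> map (map_marked f) ` mult_table p X"
        then obtain u v w where "z = triple (map f u) (map f v) (map f w)" "u \<in> X" "v \<in> X" "w \<in> X"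
          "p' (map f u @ map f v) = p' (map f w)"
          by (auto simp: mult_table_triple triple p' p)
        then show "z \<in> mult_table p' (map f ` X)"
          unfolding mult_table_triple by blast
      qed
    qed
  qed
  have words: "plus_words (f ` A) = map f ` plus_words A"
    by (auto simp: plus_words_def lists_image)
  have "sgrp_epi (f ` A) \<pi>' S"
    using assms(1) unfolding word_hyperbolic_wrt_def sgrp_combing_def sgrp_epi_def words
    by (auto simp: image_image \<pi>')
  moreover have "map f ` R \<subseteq> plus_words (f ` A)"
    using assms(1) by (auto simp: words word_hyperbolic_wrt_def sgrp_combing_def)
  ultimately show "word_hyperbolic_wrt S (f ` A) \<pi>' (map f ` R)"
    using assms(1) regular_lang_map[OF _ assms(3), of A R]
    by (auto simp: word_hyperbolic_wrt_def sgrp_combing_def image_image \<pi>' table[of \<pi>' \<pi>, OF \<pi>'(1)] context_free_map)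
  have "map f ` R \<union> {[]} = map f ` (R \<union> {[]})"
    by simp
  then show "context_free (mult_table (extend_one \<pi>') (map f ` R \<union> {[]}))"
    using assms(2) by (simp only: table[of "extend_one \<pi>'" "extend_one \<pi>", OF ext] context_free_map)
qed

text \<open>\<open>\<phi>\<close> and \<open>\<psi>\<close> translate between the generators of the combing and those of the presentation,
  inducing mutually inverse isomorphisms.\<close>

locale combed_presentation =
  fixes A :: "'a set" and \<rho> :: "('a list \<times> 'a list) set" and B :: "'b set"
    and K :: "('b list \<times> 'b list) set" and R :: "'b list set"
    and \<phi> :: "'b \<Rightarrow> 'a list" and \<psi> :: "'a \<Rightarrow> 'b list"
  assumes rho: "\<rho> \<subseteq> plus_words A \<times> plus_words A"
    and fin: "finite B"
    and equiv_K: "equiv (plus_words B) K"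
    and mult_K: "(u, v) \<in> K \<Longrightarrow> (u', v') \<in> K \<Longrightarrow> (u @ u', v @ v') \<in> K"
    and R_words: "R \<subseteq> plus_words B"
    and R_regular: "regular_lang B R"
    and R_reps: "u \<in> plus_words B \<Longrightarrow> \<exists>r\<in>R. (u, r) \<in> K"
    and cf_left: "context_free {triple u [] w | u w. u \<in> R \<and> w \<in> R \<and> (u, w) \<in> K}"
    and cf_right: "context_free {triple [] v w | v w. v \<in> R \<and> w \<in> R \<and> (v, w) \<in> K}"
    and cf_table: "context_free {triple u v w | u v w. u \<in> R \<and> v \<in> R \<and> w \<in> R \<and> (u @ v, w) \<in> K}"
    and phi: "b \<in> B \<Longrightarrow> \<phi> b \<in> plus_words A"
    and psi: "a \<in> A \<Longrightarrow> \<psi> a \<in> plus_words B"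
    and phi_K: "(u, v) \<in> K \<Longrightarrow> (concat (map \<phi> u), concat (map \<phi> v)) \<in> cong_gen A \<rho>"
    and psi_rho: "(x, y) \<in> \<rho> \<Longrightarrow> (concat (map \<psi> x), concat (map \<psi> y)) \<in> K"
    and psi_phi: "b \<in> B \<Longrightarrow> ([b], concat (map \<psi> (\<phi> b))) \<in> K"
    and phi_psi: "a \<in> A \<Longrightarrow> (concat (map \<phi> (\<psi> a)), [a]) \<in> cong_gen A \<rho>"

lemma concat_map_plus_words:
  "w \<in> plus_words A \<Longrightarrow> (\<And>a. a \<in> A \<Longrightarrow> f a \<in> plus_words B) \<Longrightarrow> concat (map f w) \<in> plus_words B"
  by (induction rule: plus_words_induct) (auto intro: plus_words_append)

text \<open>Both alphabets are evaluated in \<open>S\<close>: words over \<open>A\<close> by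
  \<open>\<tau>\<close>, words over \<open>B\<close> by \<open>\<pi>\<close>. Each generator of one
  kind is translated into some word of the other kind with the same value, and \<open>K\<close> is
  the kernel of \<open>\<pi>\<close>. The conclusion no longer mentions \<open>S\<close>.\<close>

lemma combed_presentationI:
  assumes pres: "presents A \<rho> S" and hyp: "word_hyperbolic_wrt S B \<pi> R"
    and ext: "context_free (mult_table (extend_one \<pi>) (R \<union> {[]}))"
  shows "\<exists>K \<phi> \<psi>. combed_presentation A \<rho> B K R \<phi> \<psi>"
proof -
  define C where "C = cong_gen A \<rho>"
  have rho: "\<rho> \<subseteq> plus_words A \<times> plus_words A"
    using pres by (simp add: presents_def)
  have eqC: "equiv (plus_words A) C"
    unfolding C_def by (rule equiv_cong_gen[OF rho])
  obtain h where bij: "bij_betw h (carrier (Sgp A \<rho>)) (carrier S)"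
    and hom: "\<And>x y. x \<in> carrier (Sgp A \<rho>) \<Longrightarrow> y \<in> carrier (Sgp A \<rho>) \<Longrightarrow>
      h (x \<odot>\<^bsub>Sgp A \<rho>\<^esub> y) = h x \<odot>\<^bsub>S\<^esub> h y"
    using pres by (auto simp: presents_def sgrp_iso_def)
  define \<tau> where "\<tau> x = h (C `` {x})" for x
  have car: "carrier (Sgp A \<rho>) = (\<lambda>x. C `` {x}) ` plus_words A"
    by (auto simp: Sgp_def quotient_def C_def)
  have \<tau>_onto: "\<tau> ` plus_words A = carrier S"
    using bij_betw_imp_surj_on[OF bij] by (simp add: car image_image \<tau>_def)
  have \<tau>_eq: "\<tau> x = \<tau> y \<longleftrightarrow> (x, y) \<in> C" if "x \<in> plus_words A" "y \<in> plus_words A" for x y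
  proof -
    have "\<tau> x = \<tau> y \<longleftrightarrow> C `` {x} = C `` {y}"
      using that bij by (auto simp: \<tau>_def car bij_betw_def dest: inj_onD)
    also have "\<dots> \<longleftrightarrow> (x, y) \<in> C"
      by (rule eq_equiv_class_iff[OF eqC that])
    finally show ?thesis .
  qed
  have \<tau>_mult: "\<tau> (x @ y) = \<tau> x \<odot>\<^bsub>S\<^esub> \<tau> y" if "x \<in> plus_words A" "y \<in> plus_words A" for x y
    using hom[of "C `` {x}" "C `` {y}"] Sgp_smult_class[OF rho that] that
    by (simp add: \<tau>_def car C_def)
  have \<pi>_onto: "\<pi> ` plus_words B = carrier S" and \<pi>_mult: "\<And>u v. u \<in> plus_words B \<Longrightarrow>
      v \<in> plus_words B \<Longrightarrow> \<pi> (u @ v) = \<pi> u \<odot>\<^bsub>S\<^esub> \<pi> v"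
    and comb: "finite B" "regular_lang B R" "R \<subseteq> plus_words B" "\<pi> ` R = carrier S"
    and cf: "context_free (mult_table \<pi> R)"
    using hyp by (auto simp: word_hyperbolic_wrt_def sgrp_combing_def sgrp_epi_def)
  define K where "K = {(u, v). u \<in> plus_words B \<and> v \<in> plus_words B \<and> \<pi> u = \<pi> v}"
  have "\<forall>b\<in>B. \<exists>x\<in>plus_words A. \<tau> x = \<pi> [b]"
  proof
    fix b assume "b \<in> B"
    then have "\<pi> [b] \<in> \<tau> ` plus_words A"
      unfolding \<tau>_onto \<pi>_onto[symmetric] by (intro imageI) (simp add: plus_words_def)
    then show "\<exists>x\<in>plus_words A. \<tau> x = \<pi> [b]" by force
  qed
  then obtain \<phi> where \<phi>: "\<And>b. b \<in> B \<Longrightarrow> \<phi> b \<in> plus_words A" "\<And>b. b \<in> B \<Longrightarrow> \<tau> (\<phi> b) = \<pi> [b]"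
    by metis
  have "\<forall>a\<in>A. \<exists>u\<in>plus_words B. \<pi> u = \<tau> [a]"
  proof
    fix a assume "a \<in> A"
    then have "\<tau> [a] \<in> \<pi> ` plus_words B"
      unfolding \<pi>_onto \<tau>_onto[symmetric] by (intro imageI) (simp add: plus_words_def)
    then show "\<exists>u\<in>plus_words B. \<pi> u = \<tau> [a]" by force
  qed
  then obtain \<psi> where \<psi>: "\<And>a. a \<in> A \<Longrightarrow> \<psi> a \<in> plus_words B" "\<And>a. a \<in> A \<Longrightarrow> \<pi> (\<psi> a) = \<tau> [a]"
    by metis
  have \<Phi>: "concat (map \<phi> u) \<in> plus_words A" if "u \<in> plus_words B" for u
    using that \<phi>(1) by (rule concat_map_plus_words)
  have \<Psi>: "concat (map \<psi> x) \<in> plus_words B" if "x \<in> plus_words A" for x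
    using that \<psi>(1) by (rule concat_map_plus_words)
  have letter: "[a] \<in> plus_words X" if "a \<in> X" for a X
    using that by (simp add: plus_words_def)
  have \<tau>\<Phi>: "\<tau> (concat (map \<phi> u)) = \<pi> u" if "u \<in> plus_words B" for u
    using that
  proof (induction rule: plus_words_induct)
    case (Cons b u)
    then show ?case
      using \<pi>_mult[of "[b]" u] by (simp add: \<tau>_mult \<phi> \<Phi> letter)
  qed (simp add: \<phi>)
  have \<pi>\<Psi>: "\<pi> (concat (map \<psi> x)) = \<tau> x" if "x \<in> plus_words A" for x
    using that
  proof (induction rule: plus_words_induct)
    case (Cons a x)
    then show ?case
      using \<tau>_mult[of "[a]" x] by (simp add: \<pi>_mult \<psi> \<Psi> letter)
  qed (simp add: \<psi>)
  have K_iff: "(u, v) \<in> K \<longleftrightarrow> \<pi> u = \<pi> v" if "u \<in> plus_words B" "v \<in> plus_words B" for u v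
    using that by (simp add: K_def)
  have "combed_presentation A \<rho> B K R \<phi> \<psi>"
  proof
    show "equiv (plus_words B) K"
      by (rule equivI) (auto simp: K_def refl_on_def sym_def trans_def)
    show "(u @ u', v @ v') \<in> K" if "(u, v) \<in> K" "(u', v') \<in> K" for u v u' v'
      using that by (auto simp: K_def \<pi>_mult intro: plus_words_append)
    show "\<exists>r\<in>R. (u, r) \<in> K" if "u \<in> plus_words B" for u
    proof -
      have "\<pi> u \<in> \<pi> ` R"
        using that \<pi>_onto comb(4) by blast
      then show ?thesis
        using that comb(3) by (auto simp: K_def)
    qed
    have "[] \<notin> R"
      using comb(3) by (auto simp: plus_words_def)
    note cf12 = one_sided_tables[OF ext this]
    have "{triple u [] w | u w. u \<in> R \<and> w \<in> R \<and> (u, w) \<in> K} = {triple u [] w | u w. u \<in> R \<and> w \<in> R \<and> \<pi> u = \<pi> w}"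
      using comb(3) by (auto simp: K_def)
    with cf12(1) show "context_free {triple u [] w | u w. u \<in> R \<and> w \<in> R \<and> (u, w) \<in> K}" by simp
    have "{triple [] v w | v w. v \<in> R \<and> w \<in> R \<and> (v, w) \<in> K} = {triple [] v w | v w. v \<in> R \<and> w \<in> R \<and> \<pi> v = \<pi> w}"
      using comb(3) by (auto simp: K_def)
    with cf12(2) show "context_free {triple [] v w | v w. v \<in> R \<and> w \<in> R \<and> (v, w) \<in> K}" by simp
    have "(u @ v, w) \<in> K \<longleftrightarrow> \<pi> (u @ v) = \<pi> w" if "u \<in> R" "v \<in> R" "w \<in> R" for u v w
      using that comb(3) by (intro K_iff plus_words_append) auto
    then have "{triple u v w | u v w. u \<in> R \<and> v \<in> R \<and> w \<in> R \<and> (u @ v, w) \<in> K} = mult_table \<pi> R"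
      unfolding mult_table_triple by blast
    with cf show "context_free {triple u v w | u v w. u \<in> R \<and> v \<in> R \<and> w \<in> R \<and> (u @ v, w) \<in> K}" by simp
    show "(concat (map \<phi> u), concat (map \<phi> v)) \<in> cong_gen A \<rho>" if "(u, v) \<in> K" for u v
      using that \<tau>_eq[of "concat (map \<phi> u)" "concat (map \<phi> v)"] by (auto simp: K_def C_def \<Phi> \<tau>\<Phi>)
    show "(concat (map \<psi> x), concat (map \<psi> y)) \<in> K" if "(x, y) \<in> \<rho>" for x y
    proof -
      have xy: "x \<in> plus_words A" "y \<in> plus_words A"
        using that rho by auto
      moreover have "(x, y) \<in> C"
        using that by (simp add: C_def cong_gen.base)
      ultimately show ?thesis
        by (simp add: K_iff \<Psi> \<pi>\<Psi> \<tau>_eq)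
    qed
    show "([b], concat (map \<psi> (\<phi> b))) \<in> K" if "b \<in> B" for b
      using that by (simp add: K_iff \<Psi> \<pi>\<Psi> \<phi> letter)
    show "(concat (map \<phi> (\<psi> a)), [a]) \<in> cong_gen A \<rho>" if "a \<in> A" for a
      using that \<tau>_eq[of "concat (map \<phi> (\<psi> a))" "[a]"] by (simp add: C_def \<Phi> \<tau>\<Phi> \<psi> letter)
  qed (use rho comb \<phi>(1) \<psi>(1) in auto)
  then show ?thesis by blast
qed

section \<open>The free product\<close>

locale two_combed_presentations =
  fixes A :: "bool \<Rightarrow> 'a set" and \<rho> :: "bool \<Rightarrow> ('a list \<times> 'a list) set" and B :: "bool \<Rightarrow> nat set"
    and K :: "bool \<Rightarrow> (nat list \<times> nat list) set" and R :: "bool \<Rightarrow> nat list set"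
    and \<phi> :: "bool \<Rightarrow> nat \<Rightarrow> 'a list" and \<psi> :: "bool \<Rightarrow> 'a \<Rightarrow> nat list"
  assumes side: "combed_presentation (A i) (\<rho> i) (B i) (K i) (R i) (\<phi> i) (\<psi> i)"
    and disj_A: "A True \<inter> A False = {}" and disj_B: "B True \<inter> B False = {}"
begin

sublocale tables B K R
proof
  fix i
  interpret combed_presentation "A i" "\<rho> i" "B i" "K i" "R i" "\<phi> i" "\<psi> i"
    by (rule side)
  show "equiv (plus_words (B i)) (K i)" by (rule equiv_K)
  show "(u @ u', v @ v') \<in> K i" if "(u, v) \<in> K i" "(u', v') \<in> K i" for u v u' v'
    using that by (rule mult_K)
  show "R i \<subseteq> plus_words (B i)" by (rule R_words)
  show "\<exists>r\<in>R i. (u, r) \<in> K i" if "u \<in> plus_words (B i)" for u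
    using that by (rule R_reps)
  show "context_free {triple u [] w | u w. u \<in> R i \<and> w \<in> R i \<and> (u, w) \<in> K i}" by (rule cf_left)
  show "context_free {triple [] v w | v w. v \<in> R i \<and> w \<in> R i \<and> (v, w) \<in> K i}" by (rule cf_right)
  show "context_free {triple u v w | u v w. u \<in> R i \<and> v \<in> R i \<and> w \<in> R i \<and> (u @ v, w) \<in> K i}"
    by (rule cf_table)
qed (rule disj_B)

section \<open>Translating between the generators of the presentations and of the combings\<close>

definition AA where "AA = A True \<union> A False"
definition \<rho>\<rho> where "\<rho>\<rho> = \<rho> True \<union> \<rho> False"
definition \<phi>\<phi> where "\<phi>\<phi> b = \<phi> (b \<in> B True) b"
definition \<psi>\<psi> where "\<psi>\<psi> a = \<psi> (a \<in> A True) a"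

abbreviation \<Phi> where "\<Phi> w \<equiv> concat (map \<phi>\<phi> w)"
abbreviation \<Psi> where "\<Psi> x \<equiv> concat (map \<psi>\<psi> x)"

lemma phi_side: "b \<in> B i \<Longrightarrow> \<phi>\<phi> b = \<phi> i b"
  using disj'[of b i True] by (simp add: \<phi>\<phi>_def)

lemma psi_side:
  assumes "a \<in> A i"
  shows "\<psi>\<psi> a = \<psi> i a"
proof -
  have "(a \<in> A True) = i"
    using assms disj_A by (cases i) auto
  then show ?thesis
    by (simp add: \<psi>\<psi>_def)
qed

lemma Phi_side: "w \<in> plus_words (B i) \<Longrightarrow> \<Phi> w = concat (map (\<phi> i) w)"
  by (induction rule: plus_words_induct) (auto simp: phi_side)

lemma Psi_side: "x \<in> plus_words (A i) \<Longrightarrow> \<Psi> x = concat (map (\<psi> i) x)"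
  by (induction rule: plus_words_induct) (auto simp: psi_side)

lemma A_words: "x \<in> plus_words (A i) \<Longrightarrow> x \<in> plus_words AA"
  by (cases i) (auto simp: plus_words_def AA_def)

lemma rho_words: "\<rho>\<rho> \<subseteq> plus_words AA \<times> plus_words AA"
  using combed_presentation.rho[OF side] A_words unfolding \<rho>\<rho>_def by blast

lemma cong_side: "(x, y) \<in> cong_gen (A i) (\<rho> i) \<Longrightarrow> (x, y) \<in> cong_gen AA \<rho>\<rho>"
proof (induction rule: cong_gen.induct)
  case (base u v)
  then show ?case by (cases i) (auto simp: \<rho>\<rho>_def intro: cong_gen.base)
qed (auto intro: cong_gen.intros A_words)

lemma Phi_words: "w \<in> plus_words BB \<Longrightarrow> \<Phi> w \<in> plus_words AA"
proof (erule concat_map_plus_words)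
  fix b assume "b \<in> BB"
  then obtain i where i: "b \<in> B i" by blast
  then show "\<phi>\<phi> b \<in> plus_words AA"
    using A_words[OF combed_presentation.phi[OF side i]] by (simp add: phi_side)
qed

lemma Psi_words: "x \<in> plus_words AA \<Longrightarrow> \<Psi> x \<in> plus_words BB"
proof (erule concat_map_plus_words)
  fix a assume "a \<in> AA"
  then obtain i where i: "a \<in> A i" by (auto simp: AA_def)
  then show "\<psi>\<psi> a \<in> plus_words BB"
    using plus_words_BB[OF combed_presentation.psi[OF side i]] by (simp add: psi_side)
qed

lemma Phi_Eqv: "(u, v) \<in> Eqv \<Longrightarrow> (\<Phi> u, \<Phi> v) \<in> cong_gen AA \<rho>\<rho>"
proof -
  have block: "(\<Phi> u, \<Phi> v) \<in> cong_gen AA \<rho>\<rho>" if "(u, v) \<in> K i" for u v i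
    using combed_presentation.phi_K[OF side that] K_words[OF that] cong_side by (simp add: Phi_side)
  have "eqv i u v \<Longrightarrow> (\<Phi> u, \<Phi> v) \<in> cong_gen AA \<rho>\<rho>" for i
    by (induction rule: eqv.induct) (auto intro: block cong_gen.mult)
  then show "(u, v) \<in> Eqv \<Longrightarrow> (\<Phi> u, \<Phi> v) \<in> cong_gen AA \<rho>\<rho>"
    by (auto simp: Eqv_def)
qed

text \<open>\<open>Eqv\<close> is a congruence that contains the translated relations of both
  factors, so it contains the translation of everything they generate. This is the half showing that
  the free product makes no identifications beyond the blockwise ones.\<close>

lemma Psi_cong: "(x, y) \<in> cong_gen AA \<rho>\<rho> \<Longrightarrow> (\<Psi> x, \<Psi> y) \<in> Eqv"
proof (induction rule: cong_gen.induct)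
  case (base x y)
  then obtain i where i: "(x, y) \<in> \<rho> i"
    by (auto simp: \<rho>\<rho>_def)
  then have "x \<in> plus_words (A i)" "y \<in> plus_words (A i)"
    using combed_presentation.rho[OF side] by blast+
  then show ?case
    using K_Eqv[OF combed_presentation.psi_rho[OF side i]] by (simp add: Psi_side)
next
  case (refl x)
  then show ?case by (simp add: Eqv_refl Psi_words)
qed (auto intro: Eqv_sym Eqv_trans Eqv_mult)

lemma Psi_Phi:
  assumes "w \<in> plus_words BB"
  shows "(w, \<Psi> (\<Phi> w)) \<in> Eqv"
proof -
  have block: "([b], \<Psi> (\<phi>\<phi> b)) \<in> Eqv" if "b \<in> BB" for b
  proof -
    obtain i where i: "b \<in> B i"
      using \<open>b \<in> BB\<close> by blast
    show ?thesis
      using K_Eqv[OF combed_presentation.psi_phi[OF side i]] combed_presentation.phi[OF side i]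
      by (simp add: phi_side[OF i] Psi_side)
  qed
  from assms show ?thesis
  proof (induction rule: plus_words_induct)
    case (Cons b w)
    then show ?case
      using Eqv_mult[OF block[of b], of w "\<Psi> (\<Phi> w)"] by simp
  qed (use block in simp)
qed

lemma Phi_Psi:
  assumes "x \<in> plus_words AA"
  shows "(\<Phi> (\<Psi> x), x) \<in> cong_gen AA \<rho>\<rho>"
proof -
  have block: "(\<Phi> (\<psi>\<psi> a), [a]) \<in> cong_gen AA \<rho>\<rho>" if "a \<in> AA" for a
  proof -
    obtain i where i: "a \<in> A i"
      using \<open>a \<in> AA\<close> by (auto simp: AA_def)
    show ?thesis
      using cong_side[OF combed_presentation.phi_psi[OF side i]] combed_presentation.psi[OF side i]
      by (simp add: psi_side[OF i] Phi_side)
  qed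
  from assms show ?thesis
  proof (induction rule: plus_words_induct)
    case (Cons a x)
    then show ?case
      using cong_gen.mult[OF block[of a], of "\<Phi> (\<Psi> x)" x] by simp
  qed (use block in simp)
qed

section \<open>Evaluation in the free product\<close>

definition \<pi> where "\<pi> w = cong_gen AA \<rho>\<rho> `` {\<Phi> w}"

text \<open>The normal form theorem for free products: equality there is equality block by block.
  \<open>\<Phi>\<close> carries \<open>Eqv\<close> into the congruence of the presentation;
  conversely \<open>\<Psi>\<close> carries that congruence back, and
  \<open>\<Psi> (\<Phi> u)\<close> stays in the \<open>Eqv\<close> class of
  \<open>u\<close>.\<close>

lemma pi_eq_iff:
  assumes "u \<in> plus_words BB" "v \<in> plus_words BB"
  shows "\<pi> u = \<pi> v \<longleftrightarrow> (u, v) \<in> Eqv"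
proof -
  have "\<pi> u = \<pi> v \<longleftrightarrow> (\<Phi> u, \<Phi> v) \<in> cong_gen AA \<rho>\<rho>"
    unfolding \<pi>_def using assms
    by (intro eq_equiv_class_iff[OF equiv_cong_gen[OF rho_words]] Phi_words)
  also have "\<dots> \<longleftrightarrow> (u, v) \<in> Eqv"
  proof
    assume "(\<Phi> u, \<Phi> v) \<in> cong_gen AA \<rho>\<rho>"
    from Psi_cong[OF this] show "(u, v) \<in> Eqv"
      by (intro Eqv_trans[OF Psi_Phi[OF assms(1)]] Eqv_trans[OF _ Eqv_sym[OF Psi_Phi[OF assms(2)]]])
  qed (rule Phi_Eqv)
  finally show ?thesis .
qed

lemma carrier_free_product: "carrier (Sgp AA \<rho>\<rho>) = \<pi> ` plus_words BB"
proof
  have car: "carrier (Sgp AA \<rho>\<rho>) = (\<lambda>x. cong_gen AA \<rho>\<rho> `` {x}) ` plus_words AA"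
    by (auto simp: Sgp_def quotient_def)
  show "carrier (Sgp AA \<rho>\<rho>) \<subseteq> \<pi> ` plus_words BB"
  proof
    fix X assume "X \<in> carrier (Sgp AA \<rho>\<rho>)"
    then obtain x where x: "x \<in> plus_words AA" "X = cong_gen AA \<rho>\<rho> `` {x}"
      by (auto simp: car)
    have "\<pi> (\<Psi> x) = X"
      unfolding \<pi>_def x(2) by (rule equiv_class_eq[OF equiv_cong_gen[OF rho_words] Phi_Psi[OF x(1)]])
    then show "X \<in> \<pi> ` plus_words BB"
      using Psi_words[OF x(1)] by blast
  qed
  show "\<pi> ` plus_words BB \<subseteq> carrier (Sgp AA \<rho>\<rho>)"
    using Phi_words by (auto simp: \<pi>_def car)
qed

lemma word_hyperbolic_product: "word_hyperbolic (Sgp AA \<rho>\<rho>)"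
proof -
  have "sgrp_epi BB \<pi> (Sgp AA \<rho>\<rho>)"
    using Sgp_smult_class[OF rho_words Phi_words Phi_words]
    by (simp add: sgrp_epi_def carrier_free_product \<pi>_def)
  moreover have "\<pi> ` normal_forms = carrier (Sgp AA \<rho>\<rho>)"
  proof -
    have "\<pi> w \<in> \<pi> ` normal_forms" if "w \<in> plus_words BB" for w
      using Eqv_normal_form[OF that] normal_forms_words pi_eq_iff[OF that] by blast
    then show ?thesis
      using normal_forms_words by (auto simp: carrier_free_product)
  qed
  moreover have "regular_lang BB normal_forms"
    by (rule regular_normal_forms) (rule combed_presentation.R_regular[OF side])
  moreover have "finite BB"
    using combed_presentation.fin[OF side] by simp
  moreover have "mult_table \<pi> normal_forms = {triple u v w | u v w. u \<in> normal_forms \<and>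
      v \<in> normal_forms \<and> w \<in> normal_forms \<and> (u @ v, w) \<in> Eqv}"
  proof -
    have "\<pi> (u @ v) = \<pi> w \<longleftrightarrow> (u @ v, w) \<in> Eqv"
      if "u \<in> normal_forms" "v \<in> normal_forms" "w \<in> normal_forms" for u v w
      using that normal_forms_words by (intro pi_eq_iff plus_words_append) auto
    then show ?thesis
      unfolding mult_table_triple by blast
  qed
  ultimately have "word_hyperbolic_wrt (Sgp AA \<rho>\<rho>) BB \<pi> normal_forms"
    using context_free_product_table normal_forms_words
    by (simp add: word_hyperbolic_wrt_def sgrp_combing_def)
  then show ?thesis
    unfolding word_hyperbolic_def by blast
qed

end

lemma combed_presentation_rename:
  assumes "one_extendable_word_hyperbolic S" "presents A \<rho> S" "inj (f :: nat \<Rightarrow> nat)"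
  shows "\<exists>B K R \<phi> \<psi>. combed_presentation A \<rho> (f ` B) K R \<phi> \<psi>"
proof -
  obtain B :: "nat set" and \<pi> R where "one_extendable_wrt S B \<pi> R"
    using assms(1) unfolding one_extendable_word_hyperbolic_def by blast
  then have "word_hyperbolic_wrt S B \<pi> R" "context_free (mult_table (extend_one \<pi>) (R \<union> {[]}))"
    by (auto simp: one_extendable_wrt_def monoid_word_hyperbolic_wrt_def)
  from combed_presentationI[OF assms(2) word_hyperbolic_wrt_rename[OF this assms(3)]]
  show ?thesis by blast
qed

theorem theorem1:
  fixes S1 :: "'s sgrp" and S2 :: "'t sgrp"
    and A1 A2 :: "'a set" and \<rho>1 \<rho>2 :: "('a list \<times> 'a list) set"
  assumes "sgrp S1" and "sgrp S2"
    and "one_extendable_word_hyperbolic S1" and "one_extendable_word_hyperbolic S2"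
    and "presents A1 \<rho>1 S1" and "presents A2 \<rho>2 S2" and "A1 \<inter> A2 = {}"
  shows "word_hyperbolic (free_product A1 \<rho>1 A2 \<rho>2)"
proof -
  \<comment> \<open>Even letters for one combing and odd letters for the other make the alphabets
    disjoint.\<close>
  have inj: "inj (\<lambda>n :: nat. 2 * n)" "inj (\<lambda>n :: nat. Suc (2 * n))"
    by (simp_all add: inj_def)
  obtain B1 K1 R1 \<phi>1 \<psi>1 where 1: "combed_presentation A1 \<rho>1 ((\<lambda>n :: nat. 2 * n) ` B1) K1 R1 \<phi>1 \<psi>1"
    using combed_presentation_rename[OF assms(3,5) inj(1)] by blast
  obtain B2 K2 R2 \<phi>2 \<psi>2 where 2: "combed_presentation A2 \<rho>2 ((\<lambda>n :: nat. Suc (2 * n)) ` B2) K2 R2 \<phi>2 \<psi>2"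
    using combed_presentation_rename[OF assms(4,6) inj(2)] by blast
  have "2 * m \<noteq> Suc (2 * n)" for m n :: nat
    by presburger
  then interpret two_combed_presentations "\<lambda>i. if i then A1 else A2" "\<lambda>i. if i then \<rho>1 else \<rho>2"
      "\<lambda>i. if i then (\<lambda>n. 2 * n) ` B1 else (\<lambda>n. Suc (2 * n)) ` B2" "\<lambda>i. if i then K1 else K2"
      "\<lambda>i. if i then R1 else R2" "\<lambda>i. if i then \<phi>1 else \<phi>2" "\<lambda>i. if i then \<psi>1 else \<psi>2"
    by (intro two_combed_presentations.intro) (use 1 2 assms(7) in auto)
  show ?thesis
    using word_hyperbolic_product by (simp add: free_product_def AA_def \<rho>\<rho>_def)
qed

end
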